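(* For any fixed integers $p,d>0$ there is a constant $c$ such that, for any $0<\varepsilon<1/2$, the following holds. Apply the local-search algorithm below to the metric space $\mathbb{R}^d$ with Euclidean distance $\mathrm{dist}$, an $n$-element client set $C\subset\mathbb{R}^d$, a positive integer $k$, the cost function $$\mathrm{cost}(S)=\sum_{x\in C}\Big(\min_{u\in S}\mathrm{dist}(x,u)\Big)^p,$$ and neighborhood parameter $s=1/\varepsilon^{c}$. Then the output $S$ satisfies $\mathrm{cost}(S)\le(1+\varepsilon)\min\{\mathrm{cost}(S^* ): S^*\subset\mathbb{R}^d,\ |S^*|\le k\}$.
   Context: The local-search algorithm (with inputs a metric space, a cost function, an $n$-element client set $C$, $\varepsilon>0$, and positive integers $k$ and $s$): start with $S$ an arbitrary set of $k$ points of the space; while there exists a set $S'$ of points with $|S'|\le k$, $|S\setminus S'|+|S'\setminus S|\le s$ and $\mathrm{cost}(S')\le(1-\varepsilon/n)\,\mathrm{cost}(S)$, replace $S$ by $S'$; output $S$. For $p=2$ this is the $k$-means objective and for $p=1$ the $k$-median objective. *)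

theory Defs
  imports "HOL-Analysis.Analysis"
begin

definition clustering_cost :: "nat \<Rightarrow> 'a::metric_space set \<Rightarrow> 'a set \<Rightarrow> real" where
  "clustering_cost p C S = (\<Sum>x\<in>C. (MIN u\<in>S. dist x u) ^ p)"

text \<open>
  A set of centers is required to be nonempty, since the minimum distance to the empty set is
  infinite by convention, whereas \<^const>\<open>Min\<close> of the empty set is an unspecified real.
\<close>

definition centers :: "nat \<Rightarrow> 'a set \<Rightarrow> bool" where
  "centers k S \<longleftrightarrow> finite S \<and> S \<noteq> {} \<and> card S \<le> k"

definition local_search_step ::
  "('a::metric_space set \<Rightarrow> real) \<Rightarrow> 'a set \<Rightarrow> real \<Rightarrow> nat \<Rightarrow> nat \<Rightarrow> 'a set \<Rightarrow> 'a set \<Rightarrow> bool" where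
  "local_search_step cost C \<epsilon> k s S S' \<longleftrightarrow>
     centers k S' \<and>
     card (S - S') + card (S' - S) \<le> s \<and>
     cost S' \<le> (1 - \<epsilon> / real (card C)) * cost S"

text \<open>
  The algorithm is nondeterministic in the initial set and in the choice of each replacement. A set
  is a possible output if some run reaches it and the loop condition fails there.
\<close>

definition local_search_output ::
  "('a::metric_space set \<Rightarrow> real) \<Rightarrow> 'a set \<Rightarrow> real \<Rightarrow> nat \<Rightarrow> nat \<Rightarrow> 'a set \<Rightarrow> bool" where
  "local_search_output cost C \<epsilon> k s S \<longleftrightarrow>
     (\<exists>S\<^sub>0. finite S\<^sub>0 \<and> card S\<^sub>0 = k \<and> (local_search_step cost C \<epsilon> k s)\<^sup>*\<^sup>* S\<^sub>0 S) \<and>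
     \<not> (\<exists>S'. local_search_step cost C \<epsilon> k s S S')"

end

theory Submission
  imports Defs
begin

text \<open>
  Pad the output \<open>S\<close> and a competing solution to exactly \<open>k\<close> centers \<open>L\<close> and \<open>G\<close>. Up to cheap
  modifications, \<open>G\<close> decomposes into two parts. Some of its centers are isolated: they share almost
  all their clients with a single center of \<open>L\<close>, and exchanging such a pair is a harmless swap. Among
  the \<open>k'\<close> remaining centers, at least a fraction polynomial in \<open>\<epsilon>\<close> can be closed at small cost,
  because their clients can be rerouted along clients that are served differently by \<open>L\<close> and \<open>G\<close>.

  The points that are not isolated are divided, by repeatedly cutting off the smallest dense ball,
  into regions of polynomial size. The cutting spheres carry few additional points \<open>Z\<close>, and a client
  whose two centers lie on different sides of a sphere has a point of \<open>Z\<close> no farther away than the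
  farther of the two. The closed centers pay for opening \<open>Z\<close>, so the regions can be
  grouped into boundedly many at a time such that closing the part of \<open>L\<close> in a group and
  opening the part of \<open>G\<close> together with \<open>Z\<close> keeps at most \<open>k\<close> centers. Summing the local optimality
  of \<open>S\<close> over all these swaps, of which there are at most half as many as clients, gives the ratio.
\<close>

section \<open>Selection and balancing in finite sets\<close>

text \<open>The stopping rule tolerates a gain of \<open>\<epsilon> / card C\<close> times the cost
  in every tested swap, so each tested swap adds an error; half as many swaps as clients lose
  \<open>\<epsilon> / 2\<close> in total. This is why isolated pairs are exchanged in bundles of 16,
  why the number of regions is kept near a sixteenth of the number of points, and why
  \<open>card C \<le> k\<close> and \<open>k \<le> 3\<close> get separate arguments. Isolated pairs
  are set aside because opening \<open>Z\<close> must be paid for by closed centers, and when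
  \<open>G\<close> nearly coincides with \<open>L\<close> closing any center may be expensive. For
  the pairs no separator is opened: a client that the pair serves inconsistently moves across the
  pair, and there are few such clients. All scales are powers of two with \<open>2 ^ q\<close>
  comparable to \<open>1 / \<epsilon>\<close>. Every exponent stays linear in \<open>q\<close>, so
  the swap size is polynomial in \<open>1 / \<epsilon>\<close>. Euclidean geometry enters only
  through covers of balls by boundedly many balls of half the radius, through segments crossing
  spheres, and through the infinitude of the space, which permits padding.\<close>

lemma independent_subset_of_map:
  fixes t :: "'a \<Rightarrow> 'a"
  assumes "finite K"
  shows "\<exists>S\<subseteq>K. card K \<le> 3 * card S \<and> (\<forall>f\<in>S. t f \<in> S \<longrightarrow> t f = f)"
  using assms
proof (induction "card K" arbitrary: K rule: less_induct)
  case less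
  show ?case
  proof (cases "K = {}")
    case False
    \<comment> \<open>The average number of preimages in \<open>K\<close> is at most one. Selecting
      such an \<open>f\<close> and discarding \<open>f\<close>, \<open>t f\<close> and its at most
      one preimage costs three elements per selected one. Later, independence guarantees that
      clients of a closed center are sent to an open one.\<close>
    have "\<exists>f\<in>K. card {g\<in>K. t g = f} \<le> 1"
    proof (rule ccontr)
      assume "\<not> ?thesis"
      then have "2 \<le> card {g\<in>K. t g = f}" if "f \<in> K" for f using that by fastforce
      then have "(\<Sum>f\<in>K. 2) \<le> (\<Sum>f\<in>K. card {g\<in>K. t g = f})" by (intro sum_mono)
      also have "\<dots> = card (\<Union>f\<in>K. {g\<in>K. t g = f})"
        using less.prems by (subst card_UN_disjoint) auto
      also have "\<dots> \<le> card K" using less.prems by (intro card_mono) auto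
      finally show False using False less.prems by (simp add: card_gt_0_iff)
    qed
    then obtain f where f: "f \<in> K" "card {g\<in>K. t g = f} \<le> 1" by blast
    define R where "R = insert f (insert (t f) {g\<in>K. t g = f})"
    have finR: "finite R" using less.prems by (simp add: R_def)
    have cR: "card R \<le> 3"
    proof -
      have "card R \<le> Suc (Suc (card {g\<in>K. t g = f}))"
        unfolding R_def using less.prems by (auto simp: card_insert_if)
      then show ?thesis using f(2) by linarith
    qed
    have "card (K - R) < card K" using less.prems f(1) by (intro psubset_card_mono) (auto simp: R_def)
    from less.hyps[OF this] less.prems obtain S where
      S: "S \<subseteq> K - R" "card (K - R) \<le> 3 * card S" "\<forall>f\<in>S. t f \<in> S \<longrightarrow> t f = f" by auto
    have "finite S" using S(1) less.prems finite_subset by blast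
    moreover have "f \<notin> S" using S(1) by (auto simp: R_def)
    moreover have "card K \<le> card (K - R) + card R"
      using diff_card_le_card_Diff[OF finR, of K] by linarith
    ultimately have "card K \<le> 3 * card (insert f S)" using S(2) cR by simp
    moreover have "\<forall>g\<in>insert f S. t g \<in> insert f S \<longrightarrow> t g = g"
      using S(1,3) by (auto simp: R_def)
    ultimately show ?thesis using S(1) f(1) by (intro exI[of _ "insert f S"]) auto
  qed auto
qed

text \<open>Dropping an element of maximal weight does not increase the average weight.\<close>

lemma cheap_subset:
  fixes w :: "'a \<Rightarrow> real"
  assumes "finite K" "m \<le> card K"
  shows "\<exists>S\<subseteq>K. card S = m \<and> card K * sum w S \<le> m * sum w K"
  using assms
proof (induction "card K - m" arbitrary: K)
  case 0
  then show ?case by (intro exI[of _ K]) auto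
next
  case (Suc n)
  then have "K \<noteq> {}" by auto
  have "Max (w ` K) \<in> w ` K" using Suc.prems(1) \<open>K \<noteq> {}\<close> by (intro Max_in) auto
  then obtain a where "a \<in> K" "Max (w ` K) = w a" by blast
  then have a: "a \<in> K" "\<And>b. b \<in> K \<Longrightarrow> w b \<le> w a"
    using Max_ge[of "w ` K"] Suc.prems(1) by auto
  have c: "card (K - {a}) = card K - 1" using a Suc.prems by simp
  from Suc.hyps(1)[of "K - {a}"] Suc.hyps(2) Suc.prems c obtain S where
    S: "S \<subseteq> K - {a}" "card S = m" "card (K - {a}) * sum w S \<le> m * sum w (K - {a})"
    by fastforce
  have "finite S" using S(1) Suc.prems finite_subset by blast
  have "sum w S \<le> (\<Sum>x\<in>S. w a)" using S(1) a(2) by (intro sum_mono) auto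
  then have 1: "sum w S \<le> m * w a" using S(2) by simp
  have 2: "sum w K = sum w (K - {a}) + w a" using a Suc.prems by (simp add: sum.remove)
  have 3: "real (card K) = real (card (K - {a})) + 1" using c a Suc.prems card_gt_0_iff[of K] by fastforce
  have "card K * sum w S \<le> m * sum w K" using S(3) 1 unfolding 2 3 by (simp add: algebra_simps)
  then show ?case using S by blast
qed

lemma bounded_partial_sums_chain:
  fixes d :: "'a \<Rightarrow> int"
  assumes "finite I" "n \<le> card I" "\<And>i. i \<in> I \<Longrightarrow> \<bar>d i\<bar> \<le> D" "0 \<le> sum d I" "0 \<le> D"
    and no: "\<And>i. i \<in> I \<Longrightarrow> 0 \<le> d i \<Longrightarrow> sum d (I - {i}) < 0"
  shows "\<exists>J :: nat \<Rightarrow> 'a set. \<forall>i\<le>n. J i \<subseteq> I \<and> card (J i) = i \<and> \<bar>sum d (J i)\<bar> \<le> D \<and> (\<forall>k\<le>i. J k \<subseteq> J i)"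
  using assms(2)
proof (induction n)
  case 0
  show ?case using assms by (intro exI[of _ "\<lambda>_. {}"]) auto
next
  case (Suc n)
  then obtain J :: "nat \<Rightarrow> 'a set" where J: "\<And>i. i \<le> n \<Longrightarrow> J i \<subseteq> I \<and> card (J i) = i \<and> \<bar>sum d (J i)\<bar> \<le> D \<and> (\<forall>k\<le>i. J k \<subseteq> J i)"
    by auto
  have fin: "finite (J n)" using J[of n] assms(1) finite_subset by blast
  have split: "sum d I = sum d (I - J n) + sum d (J n)"
    using J[of n] assms(1) by (simp add: sum.subset_diff)
  have ne: "I - J n \<noteq> {}"
  proof
    assume "I - J n = {}"
    then have "card I \<le> card (J n)" using fin by (intro card_mono) auto
    then show False using J[of n] Suc.prems by simp
  qed
  have "\<exists>a\<in>I - J n. \<bar>sum d (J n) + d a\<bar> \<le> D"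
  proof (cases "sum d (J n) \<le> 0")
    case True
    have "\<exists>a\<in>I - J n. 0 \<le> d a"
    proof (rule ccontr)
      assume "\<not> ?thesis"
      then have "sum d (I - J n) < 0" using ne assms(1) sum_strict_mono[of "I - J n" d "\<lambda>_. 0"] by (simp add: not_le)
      then show False using split True assms(4) by linarith
    qed
    then obtain a where "a \<in> I - J n" "0 \<le> d a" by blast
    then show ?thesis using True J[of n] assms(3)[of a] by (intro bexI[of _ a]) auto
  next
    case False
    have "\<exists>a\<in>I - J n. d a \<le> 0"
    proof (rule ccontr)
      assume neg: "\<not> ?thesis"
      obtain a where a: "a \<in> I - J n" using ne by blast
      have "sum d (I - {a}) = sum d (I - J n - {a}) + sum d (J n)"
        using a J[of n] assms(1) split by (simp add: sum_diff1)
      moreover have "0 \<le> sum d (I - J n - {a})" using neg by (intro sum_nonneg) (auto simp: not_le less_imp_le)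
      ultimately show False using no[of a] a neg False by (smt (verit) DiffD1)
    qed
    then obtain a where "a \<in> I - J n" "d a \<le> 0" by blast
    then show ?thesis using False J[of n] assms(3)[of a] by (intro bexI[of _ a]) auto
  qed
  then obtain a where a: "a \<in> I - J n" "\<bar>sum d (J n) + d a\<bar> \<le> D" by blast
  show ?case
    using J a fin by (intro exI[of _ "J(Suc n := insert a (J n))"]) (auto simp: le_Suc_eq add.commute)
qed

text \<open>Adding elements whose sign is opposite to the current partial sum keeps all partial sums in
  \<open>{-D..D}\<close>, so two of the first \<open>2 * D + 2\<close> of them agree.\<close>

lemma balanced_subset:
  fixes d :: "'a \<Rightarrow> int"
  assumes "finite I" "I \<noteq> {}" "\<And>i. i \<in> I \<Longrightarrow> \<bar>d i\<bar> \<le> int D" "0 \<le> sum d I"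
  shows "\<exists>J\<subseteq>I. J \<noteq> {} \<and> card J \<le> 2 * D + 1 \<and> 0 \<le> sum d J \<and> 0 \<le> sum d (I - J)"
proof (cases "card I \<le> 2 * D + 1")
  case True
  then show ?thesis using assms by (intro exI[of _ I]) auto
next
  case False
  show ?thesis
  proof (cases "\<exists>i\<in>I. 0 \<le> d i \<and> 0 \<le> sum d (I - {i})")
    case True
    then obtain i where "i \<in> I" "0 \<le> d i" "0 \<le> sum d (I - {i})" by blast
    then show ?thesis by (intro exI[of _ "{i}"]) auto
  next
    case no: False
    obtain J :: "nat \<Rightarrow> 'a set" where J: "\<And>i. i \<le> 2 * D + 1 \<Longrightarrow> J i \<subseteq> I \<and> card (J i) = i \<and>
        \<bar>sum d (J i)\<bar> \<le> int D \<and> (\<forall>k\<le>i. J k \<subseteq> J i)"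
      using bounded_partial_sums_chain[of I "2 * D + 1" d "int D"] assms False no by fastforce
    have "\<not> inj_on (\<lambda>i. sum d (J i)) {..2 * D + 1}"
    proof
      assume "inj_on (\<lambda>i. sum d (J i)) {..2 * D + 1}"
      then have "card {..2 * D + 1} \<le> card {- int D..int D}"
        using J by (intro card_inj_on_le) (auto simp: abs_le_iff minus_le_iff)
      then show False by simp
    qed
    then obtain a b where ab: "a < b" "b \<le> 2 * D + 1" "sum d (J a) = sum d (J b)"
      unfolding inj_on_def by (metis atMost_iff linorder_neqE_nat)
    have sub: "J a \<subseteq> J b" "J b \<subseteq> I" using J[of b] ab by auto
    have fin: "finite (J b)" using sub assms(1) finite_subset by blast
    have s0: "sum d (J b - J a) = 0" using ab sub fin by (simp add: sum_diff)
    have "card (J b - J a) = b - a" using J[of a] J[of b] ab card_Diff_subset[OF finite_subset[OF sub(1) fin] sub(1)] by simp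
    then have "J b - J a \<noteq> {}" "card (J b - J a) \<le> 2 * D + 1" using ab by (metis card.empty less_numeral_extra(3) zero_less_diff, simp)
    moreover have "sum d (I - (J b - J a)) = sum d I" using s0 sub assms(1) by (subst sum_diff) auto
    ultimately show ?thesis using s0 sub assms(4) by (intro exI[of _ "J b - J a"]) auto
  qed
qed

text \<open>A balanced subset leaves a complement of nonnegative sum, so the complement can be split
  again. The parts become swaps later, hence the bound on their number.\<close>

lemma balanced_partition:
  fixes d :: "'a \<Rightarrow> int"
  assumes "finite I" "\<And>i. i \<in> I \<Longrightarrow> \<bar>d i\<bar> \<le> int D" "0 \<le> sum d I"
  shows "\<exists>\<J>. finite \<J> \<and> \<Union>\<J> = I \<and> disjoint \<J> \<and> card \<J> \<le> card I \<and>
     (\<forall>J\<in>\<J>. card J \<le> 2 * D + 1 \<and> 0 \<le> sum d J)"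
  using assms
proof (induction "card I" arbitrary: I rule: less_induct)
  case less
  show ?case
  proof (cases "I = {}")
    case True
    then show ?thesis by (intro exI[of _ "{}"]) auto
  next
    case False
    obtain J where J: "J \<subseteq> I" "J \<noteq> {}" "card J \<le> 2 * D + 1" "0 \<le> sum d J" "0 \<le> sum d (I - J)"
      using balanced_subset[of I d D] less.prems False by blast
    have lt: "card (I - J) < card I" using J less.prems by (intro psubset_card_mono) auto
    obtain \<J> where K: "finite \<J>" "\<Union>\<J> = I - J" "disjoint \<J>" "card \<J> \<le> card (I - J)"
      "\<forall>J\<in>\<J>. card J \<le> 2 * D + 1 \<and> 0 \<le> sum d J"
      using less.hyps[OF lt] less.prems J by auto
    show ?thesis
    proof (intro exI[of _ "insert J \<J>"] conjI)
      show "card (insert J \<J>) \<le> card I" using K(1,4) lt by (simp add: card_insert_if)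
      show "disjoint (insert J \<J>)" using K(2,3) by (auto simp: disjoint_def pairwise_insert disjnt_def)
    qed (use J K in auto)
  qed
qed

lemma chunk_partition:
  assumes "finite I" "0 < b"
  shows "\<exists>\<J>. finite \<J> \<and> \<Union>\<J> = I \<and> disjoint \<J> \<and> card \<J> \<le> card I div b + 1 \<and> (\<forall>J\<in>\<J>. card J \<le> b)"
proof -
  obtain e where e: "bij_betw e I {0..<card I}" using ex_bij_betw_finite_nat[OF assms(1)] by blast
  define ch where "ch j = {i\<in>I. e i div b = j}" for j
  show ?thesis
  proof (intro exI[of _ "ch ` {..card I div b}"] conjI ballI)
    show "card (ch ` {..card I div b}) \<le> card I div b + 1"
      using card_image_le[of "{..card I div b}" ch] by simp
    have "e i div b \<le> card I div b" if "i \<in> I" for i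
      using bij_betwE[OF e] that by (intro div_le_mono) (auto intro: less_imp_le)
    then show "\<Union> (ch ` {..card I div b}) = I" by (auto simp: ch_def)
    show "disjoint (ch ` {..card I div b})" by (auto simp: disjoint_def ch_def)
    fix J assume "J \<in> ch ` {..card I div b}"
    then obtain j where J: "J = ch j" by blast
    have "e i \<in> {j * b..<j * b + b}" if "i \<in> ch j" for i
      using that assms(2) div_mult_mod_eq[of "e i" b] mod_less_divisor[of b "e i"]
      by (simp add: ch_def del: div_mult_mod_eq mod_less_divisor)
    then have "e ` ch j \<subseteq> {j * b..<j * b + b}" by blast
    moreover have "inj_on e (ch j)" using e by (auto simp: bij_betw_def ch_def intro: inj_on_subset)
    ultimately have "card (ch j) \<le> card {j * b..<j * b + b}" by (intro card_inj_on_le) auto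
    then show "card J \<le> b" using J by simp
  qed auto
qed

section \<open>Dividing finite point sets by spheres\<close>

text \<open>The form is dictated by the swaps: a client \<open>x\<close> that loses \<open>u\<close>
  while \<open>v\<close> is not opened can move to some \<open>z\<close> without exceeding the
  larger of its two distances. Here \<open>x\<close> ranges over the whole space because the
  division looks only at centers, never at clients.\<close>

definition separates :: "'a::metric_space set \<Rightarrow> 'a set \<Rightarrow> 'a set \<Rightarrow> bool" where
  "separates Z U V \<longleftrightarrow> (\<forall>u\<in>U. \<forall>v\<in>V. \<forall>x. \<exists>z\<in>Z. dist x z \<le> max (dist x u) (dist x v))"

text \<open>Compactness gives a finite net of the unit ball; scaling and translation carry it to all
  balls with the same size.\<close>

lemma cball_halving:
  "\<exists>\<kappa>::nat. 1 \<le> \<kappa> \<and> (\<forall>(c::'a::euclidean_space) R. 0 < R \<longrightarrow>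
     (\<exists>F. finite F \<and> card F \<le> \<kappa> \<and> cball c R \<subseteq> (\<Union>f\<in>F. cball f (R / 2))))"
proof -
  have "cball (0::'a) 1 \<subseteq> (\<Union>f\<in>UNIV. ball f (1/2))"
  proof
    fix x :: 'a show "x \<in> (\<Union>f\<in>UNIV. ball f (1/2))" by (auto intro!: exI[of _ x])
  qed
  then obtain F where F: "finite F" "cball (0::'a) 1 \<subseteq> (\<Union>f\<in>F. ball f (1/2))"
    using compactE_image[OF compact_cball, of UNIV "\<lambda>f. ball f (1/2)" "0::'a" 1] by (metis open_ball)
  show ?thesis
  proof (intro exI[of _ "card F + 1"] conjI allI impI)
    fix c :: 'a and R :: real assume R: "0 < R"
    let ?F = "(\<lambda>f. c + R *\<^sub>R f) ` F"
    have "cball c R \<subseteq> (\<Union>f\<in>?F. cball f (R / 2))"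
    proof
      fix x assume x: "x \<in> cball c R"
      define y where "y = (x - c) /\<^sub>R R"
      have xy: "x = c + R *\<^sub>R y" using R by (simp add: y_def)
      have "norm (x - c) \<le> R" using x by (simp add: dist_norm norm_minus_commute)
      then have "y \<in> cball 0 1" using R by (simp add: y_def divide_simps)
      then obtain f where f: "f \<in> F" "dist f y < 1/2" using F by auto
      have "dist (c + R *\<^sub>R f) x = R * dist f y"
        using R by (simp add: xy dist_norm flip: scaleR_diff_right)
      then show "x \<in> (\<Union>f\<in>?F. cball f (R / 2))" using f R by (auto intro!: bexI[of _ f])
    qed
    then show "\<exists>F'. finite F' \<and> card F' \<le> card F + 1 \<and> cball c R \<subseteq> (\<Union>f\<in>F'. cball f (R / 2))"
      using F(1) card_image_le[OF F(1), of "\<lambda>f. c + R *\<^sub>R f"]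
      by (intro exI[of _ ?F]) auto
  qed auto
qed

lemma cball_power_cover:
  "\<exists>\<kappa>::nat. 1 \<le> \<kappa> \<and> (\<forall>j (c::'a::euclidean_space) R. 0 < R \<longrightarrow>
     (\<exists>F. finite F \<and> card F \<le> \<kappa> ^ j \<and> cball c R \<subseteq> (\<Union>f\<in>F. cball f (R / 2 ^ j))))"
proof -
  obtain \<kappa> :: nat where \<kappa>: "1 \<le> \<kappa>" "\<And>(c::'a) R. 0 < R \<Longrightarrow>
     \<exists>F. finite F \<and> card F \<le> \<kappa> \<and> cball c R \<subseteq> (\<Union>f\<in>F. cball f (R / 2))"
    using cball_halving by blast
  have "\<exists>F. finite F \<and> card F \<le> \<kappa> ^ j \<and> cball c R \<subseteq> (\<Union>f\<in>F. cball f (R / 2 ^ j))"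
    if "0 < R" for j and c :: 'a and R
  proof (induction j)
    case 0
    show ?case by (intro exI[of _ "{c}"]) auto
  next
    case (Suc j)
    then obtain F where F: "finite F" "card F \<le> \<kappa> ^ j" "cball c R \<subseteq> (\<Union>f\<in>F. cball f (R / 2 ^ j))" by blast
    have pos: "0 < R / 2 ^ j" using that by simp
    define H where "H f = (SOME H. finite H \<and> card H \<le> \<kappa> \<and> cball f (R / 2 ^ j) \<subseteq> (\<Union>h\<in>H. cball h (R / 2 ^ j / 2)))" for f :: 'a
    have H: "finite (H f) \<and> card (H f) \<le> \<kappa> \<and> cball f (R / 2 ^ j) \<subseteq> (\<Union>h\<in>H f. cball h (R / 2 ^ j / 2))" for f
      unfolding H_def by (rule someI_ex[OF \<kappa>(2)[OF pos]])
    have "card (\<Union>f\<in>F. H f) \<le> (\<Sum>f\<in>F. card (H f))" using F(1) by (rule card_UN_le)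
    also have "\<dots> \<le> card F * \<kappa>" using H sum_bounded_above[of F "\<lambda>f. card (H f)" \<kappa>] by simp
    also have "\<dots> \<le> \<kappa> ^ Suc j" using F(2) by (simp add: mult.commute)
    finally have "card (\<Union>f\<in>F. H f) \<le> \<kappa> ^ Suc j" .
    moreover have "cball c R \<subseteq> (\<Union>h\<in>(\<Union>f\<in>F. H f). cball h (R / 2 ^ Suc j))"
    proof
      fix x assume "x \<in> cball c R"
      then obtain f where f: "f \<in> F" "x \<in> cball f (R / 2 ^ j)" using F(3) by blast
      then obtain h where "h \<in> H f" "x \<in> cball h (R / 2 ^ j / 2)" using H by blast
      then show "x \<in> (\<Union>h\<in>(\<Union>f\<in>F. H f). cball h (R / 2 ^ Suc j))" using f(1) by (auto simp: mult.commute)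
    qed
    ultimately show ?case using F(1) H by (intro exI[of _ "\<Union>f\<in>F. H f"]) auto
  qed
  then show ?thesis using \<kappa>(1) by blast
qed

lemma segment_meets_sphere:
  fixes q :: "'a::euclidean_space"
  assumes "dist q a \<le> t" "t \<le> dist q b"
  shows "\<exists>y. dist q y = t \<and> dist a b = dist a y + dist y b"
proof -
  have "connected ((\<lambda>y. dist q y) ` closed_segment a b)"
    by (intro connected_continuous_image continuous_intros connected_segment)
  then have "t \<in> (\<lambda>y. dist q y) ` closed_segment a b"
    using assms connectedD_interval[of "(\<lambda>y. dist q y) ` closed_segment a b" "dist q a" "dist q b" t] by auto
  then show ?thesis by (auto simp: between_mem_segment[symmetric] between)
qed

text \<open>A segment from \<open>x\<close> to the point on the other side of the sphere crosses it at some \<open>y\<close>; the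
  net point next to \<open>y\<close> is at most \<open>w\<close> away from \<open>y\<close>, while both \<open>u\<close> and \<open>v\<close> are at least \<open>w\<close> away.\<close>

lemma sphere_net_separates:
  fixes q :: "'a::euclidean_space"
  assumes net: "cball q t \<subseteq> (\<Union>f\<in>F. cball f w)" and w: "0 \<le> w"
  shows "separates F {u. dist q u \<le> t - w} {v. t + w \<le> dist q v}"
  unfolding separates_def
proof (intro ballI allI)
  fix u v x assume "u \<in> {u. dist q u \<le> t - w}" "v \<in> {v. t + w \<le> dist q v}"
  then have u: "dist q u \<le> t - w" and v: "t + w \<le> dist q v" by auto
  have *: "\<exists>z\<in>F. dist x z \<le> dist x b"
    if y: "dist q y = t" "dist x b = dist x y + dist y b" and b: "w \<le> dist y b" for y b
  proof -
    obtain z where "z \<in> F" "dist y z \<le> w" using net y(1) by (force simp: dist_commute)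
    then show ?thesis using dist_triangle[of x z y] y(2) b by (intro bexI[of _ z]) auto
  qed
  show "\<exists>z\<in>F. dist x z \<le> max (dist x u) (dist x v)"
  proof (cases "dist q x \<le> t")
    case True
    then obtain y where y: "dist q y = t" "dist x v = dist x y + dist y v"
      using segment_meets_sphere[of q x t v] v w by auto
    have "w \<le> dist y v" using dist_triangle[of q v y] v y by (simp add: dist_commute)
    from *[OF y this] show ?thesis by (meson max.coboundedI2)
  next
    case False
    then obtain y where y: "dist q y = t" "dist u x = dist u y + dist y x"
      using segment_meets_sphere[of q u t x] u w by auto
    have "w \<le> dist y u" using dist_triangle[of q y u] u y by (simp add: dist_commute)
    then have "\<exists>z\<in>F. dist x z \<le> dist x u" using *[of y u] y by (simp add: dist_commute)
    then show ?thesis by (meson max.coboundedI1)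
  qed
qed

text \<open>Pigeonhole: the \<open>M\<close> open annuli of width \<open>2 * w\<close> are disjoint
  and lie in one ball, so some annulus holds at most the average number of points.\<close>

lemma sparse_annulus:
  assumes "finite Q" "0 < M" "0 \<le> w"
  shows "\<exists>i<M. M * card {a\<in>Q. s + 2 * real i * w < dist q a \<and> dist q a < s + 2 * real (Suc i) * w}
    \<le> card (Q \<inter> cball q (s + 2 * real M * w))"
proof -
  define N where "N i = {a\<in>Q. s + 2 * real i * w < dist q a \<and> dist q a < s + 2 * real (Suc i) * w}" for i
  have mono: "s + 2 * real i * w \<le> s + 2 * real j * w" if "i \<le> j" for i j
    using that assms(3) by (simp add: mult_right_mono)
  have disj: "N i \<inter> N j = {}" if "i < j" for i j
    using mono[of "Suc i" j] that by (auto simp: N_def)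
  have "\<exists>i<M. M * card (N i) \<le> card (Q \<inter> cball q (s + 2 * real M * w))"
  proof (rule ccontr)
    assume "\<not> ?thesis"
    then have lt: "card (Q \<inter> cball q (s + 2 * real M * w)) < M * card (N i)" if "i < M" for i
      using that by (meson not_le)
    have "M * card (Q \<inter> cball q (s + 2 * real M * w)) = (\<Sum>i<M. card (Q \<inter> cball q (s + 2 * real M * w)))" by simp
    also have "\<dots> < (\<Sum>i<M. M * card (N i))" using lt assms(2) by (intro sum_strict_mono) auto
    also have "\<dots> = M * card (\<Union>i<M. N i)"
    proof -
      have "card (\<Union>i<M. N i) = (\<Sum>i<M. card (N i))"
      proof (intro card_UN_disjoint ballI impI)
        fix i j :: nat assume "i \<noteq> j"
        then show "N i \<inter> N j = {}" using disj[of i j] disj[of j i] by (metis Int_commute linorder_neqE_nat)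
      qed (use assms in \<open>auto simp: N_def\<close>)
      then show ?thesis by (simp add: sum_distrib_left)
    qed
    also have "\<dots> \<le> M * card (Q \<inter> cball q (s + 2 * real M * w))"
    proof (intro mult_le_mono card_mono)
      show "(\<Union>i<M. N i) \<subseteq> Q \<inter> cball q (s + 2 * real M * w)"
      proof
        fix a assume "a \<in> (\<Union>i<M. N i)"
        then obtain i where "i < M" "a \<in> N i" by blast
        then show "a \<in> Q \<inter> cball q (s + 2 * real M * w)" using mono[of "Suc i" M] by (auto simp: N_def)
      qed
    qed (use assms in auto)
    finally show False by simp
  qed
  then show ?thesis unfolding N_def .
qed

text \<open>Let \<open>\<rho>\<close> be the least distance from a point \<open>a\<close> of
  \<open>Q\<close> to a point of \<open>Q\<close> such that the ball about \<open>a\<close> of that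
  radius is dense. A dense ball of radius \<open>\<rho> / 4\<close> about an arbitrary
  \<open>y\<close> lies in the ball of radius \<open>\<rho> / 2\<close> about any point of
  \<open>Q\<close> inside it, against minimality. Density with \<open>2 \<le> r\<close> excludes
  \<open>\<rho> = 0\<close>.\<close>

lemma dense_ball_exists:
  fixes Q :: "'a::metric_space set"
  assumes "finite Q" "r \<le> card Q" "2 \<le> r"
  obtains q \<rho> where "0 < \<rho>" "r \<le> card (Q \<inter> cball q \<rho>)"
    "\<And>y. card (Q \<inter> cball y (\<rho> / 4)) < r"
proof -
  define D where "D = {dist a b | a b. a \<in> Q \<and> b \<in> Q \<and> r \<le> card (Q \<inter> cball a (dist a b))}"
  have attain: "\<exists>\<rho>'\<in>D. \<rho>' \<le> \<rho>" if a: "a \<in> Q" "r \<le> card (Q \<inter> cball a \<rho>)" for a \<rho>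
  proof -
    let ?X = "(\<lambda>b. dist a b) ` (Q \<inter> cball a \<rho>)"
    have ne: "Q \<inter> cball a \<rho> \<noteq> {}" using a assms(3) by auto
    then have "Max ?X \<in> ?X" using assms(1) by (intro Max_in) auto
    then obtain b where b: "b \<in> Q \<inter> cball a \<rho>" "Max ?X = dist a b" by blast
    have "Q \<inter> cball a \<rho> \<subseteq> Q \<inter> cball a (dist a b)"
      using assms(1) unfolding b(2)[symmetric] by auto
    then have "r \<le> card (Q \<inter> cball a (dist a b))"
      using a(2) assms(1) by (meson card_mono finite_Int order_trans)
    then show ?thesis using a(1) b(1) by (auto simp: D_def)
  qed
  have fin: "finite D"
    by (rule finite_subset[of _ "(\<lambda>(a, b). dist a b) ` (Q \<times> Q)"]) (use assms in \<open>auto simp: D_def\<close>)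
  obtain a0 where a0: "a0 \<in> Q" using assms by fastforce
  have "Q \<subseteq> cball a0 (Max ((\<lambda>b. dist a0 b) ` Q))" using assms(1) by auto
  then have "D \<noteq> {}" using attain[OF a0, of "Max ((\<lambda>b. dist a0 b) ` Q)"] assms(2) by (auto simp: Int_absorb2)
  then have "Min D \<in> D" using fin by simp
  then obtain q b where q: "q \<in> Q" "b \<in> Q" "Min D = dist q b" "r \<le> card (Q \<inter> cball q (Min D))"
    unfolding D_def by auto
  have "0 < Min D"
  proof (rule ccontr)
    assume "\<not> 0 < Min D"
    then have "Q \<inter> cball q (Min D) \<subseteq> {q}" using q(3) by auto
    then have "card (Q \<inter> cball q (Min D)) \<le> 1" using card_mono[of "{q}"] by fastforce
    then show False using q assms(3) by linarith
  qed
  moreover have "card (Q \<inter> cball y (Min D / 4)) < r" for y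
  proof (rule ccontr)
    assume "\<not> ?thesis"
    then have big: "r \<le> card (Q \<inter> cball y (Min D / 4))" by simp
    then obtain a where a: "a \<in> Q" "dist y a \<le> Min D / 4"
      using assms(3) by (metis Int_iff card.empty equals0I le_zero_eq mem_cball not_numeral_le_zero)
    have "cball y (Min D / 4) \<subseteq> cball a (Min D / 2)"
    proof
      fix z assume "z \<in> cball y (Min D / 4)"
      then show "z \<in> cball a (Min D / 2)" using dist_triangle[of a z y] a(2) by (simp add: dist_commute)
    qed
    then have "r \<le> card (Q \<inter> cball a (Min D / 2))"
      using big assms(1) by (meson Int_mono card_mono finite_Int order_refl order_trans)
    then obtain \<rho>' where "\<rho>' \<in> D" "\<rho>' \<le> Min D / 2" using attain a(1) by blast
    then show False using Min_le[OF fin] \<open>0 < Min D\<close> by fastforce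
  qed
  ultimately show thesis using that q(4) by blast
qed

text \<open>Three halvings take radius \<open>2 * \<rho>\<close> to \<open>\<rho> / 4\<close>, where
  balls hold fewer than \<open>r\<close> points; this bounds \<open>U\<close>. The cutting sphere
  runs in the middle of a sparse annulus. The points of \<open>Q\<close> in that annulus join
  \<open>Z\<close>, so all others keep distance \<open>w\<close> from the sphere and a net of mesh
  \<open>w\<close> separates them.\<close>

lemma ball_cut:
  fixes Q :: "'a::euclidean_space set"
  assumes cov: "\<And>j (c::'a) R. 0 < R \<Longrightarrow> \<exists>F. finite F \<and> card F \<le> \<kappa> ^ j \<and> cball c R \<subseteq> (\<Union>f\<in>F. cball f (R / 2 ^ j))"
    and Q: "finite Q" "r \<le> card Q" "2 \<le> r"
  shows "\<exists>U Z. U \<subseteq> Q \<and> r \<le> card U \<and> card U \<le> \<kappa> ^ 3 * r \<and> finite Z \<and>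
    2 ^ j * card Z \<le> \<kappa> ^ 3 * r + 2 ^ j * \<kappa> ^ (j + 2) \<and> separates Z U (Q - U)"
proof -
  obtain q \<rho> where \<rho>: "0 < \<rho>" "r \<le> card (Q \<inter> cball q \<rho>)" "\<And>y. card (Q \<inter> cball y (\<rho> / 4)) < r"
    using dense_ball_exists[OF Q] by blast
  have big: "card (Q \<inter> cball q (2 * \<rho>)) \<le> \<kappa> ^ 3 * r"
  proof -
    obtain F where F: "finite F" "card F \<le> \<kappa> ^ 3" "cball q (2 * \<rho>) \<subseteq> (\<Union>f\<in>F. cball f (2 * \<rho> / 2 ^ 3))"
      using cov[of "2 * \<rho>" 3 q] \<rho>(1) by auto
    have "card (Q \<inter> cball q (2 * \<rho>)) \<le> card (\<Union>f\<in>F. Q \<inter> cball f (\<rho> / 4))"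
      using F Q(1) by (intro card_mono) auto
    also have "\<dots> \<le> (\<Sum>f\<in>F. card (Q \<inter> cball f (\<rho> / 4)))" using F(1) by (rule card_UN_le)
    also have "\<dots> \<le> (\<Sum>f\<in>F. r)" using \<rho>(3) by (intro sum_mono) (simp add: less_imp_le)
    also have "\<dots> \<le> \<kappa> ^ 3 * r" using F(2) by simp
    finally show ?thesis .
  qed
  \<comment> \<open>With this width, \<open>2 ^ j\<close> annuli of width \<open>2 * w\<close>
    exactly fill the shell between \<open>\<rho>\<close> and \<open>2 * \<rho>\<close>, and
    \<open>j + 2\<close> halvings of \<open>2 * \<rho>\<close> give a net of mesh
    \<open>w\<close>.\<close>
  define w where "w = \<rho> / 2 ^ (j + 1)"
  have w: "0 < w" "2 * 2 ^ j * w = \<rho>" using \<rho>(1) by (auto simp: w_def)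
  obtain i where i: "i < 2 ^ j" "2 ^ j * card {a\<in>Q. \<rho> + 2 * real i * w < dist q a \<and> dist q a < \<rho> + 2 * real (Suc i) * w}
     \<le> card (Q \<inter> cball q (\<rho> + 2 * real (2 ^ j) * w))"
    using sparse_annulus[OF Q(1), of "2 ^ j" w \<rho> q] w(1) by auto
  define t where "t = \<rho> + 2 * real i * w + w"
  define N where "N = {a\<in>Q. t - w < dist q a \<and> dist q a < t + w}"
  have "N = {a\<in>Q. \<rho> + 2 * real i * w < dist q a \<and> dist q a < \<rho> + 2 * real (Suc i) * w}"
    by (auto simp: N_def t_def algebra_simps)
  then have N: "2 ^ j * card N \<le> \<kappa> ^ 3 * r" using i(2) w(2) big by simp
  have "real (Suc i) \<le> real (2 ^ j)" using i(1) by (simp only: of_nat_le_iff Suc_le_eq)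
  then have "2 * real (Suc i) * w \<le> 2 * 2 ^ j * w" using w(1) by (intro mult_right_mono) auto
  then have t: "\<rho> \<le> t" "t \<le> 2 * \<rho>" using w by (auto simp: t_def algebra_simps)
  obtain F where F: "finite F" "card F \<le> \<kappa> ^ (j + 2)" "cball q (2 * \<rho>) \<subseteq> (\<Union>f\<in>F. cball f (2 * \<rho> / 2 ^ (j + 2)))"
    using cov[of "2 * \<rho>" "j + 2" q] \<rho>(1) by auto
  have "2 * \<rho> / 2 ^ (j + 2) = w" by (simp add: w_def)
  then have net: "cball q t \<subseteq> (\<Union>f\<in>F. cball f w)" using F(3) subset_cball[OF t(2), of q] by auto
  define U where "U = Q \<inter> cball q t"
  have "separates (F \<union> N) U (Q - U)"
    unfolding separates_def
  proof (intro ballI allI)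
    fix u v x assume uv: "u \<in> U" "v \<in> Q - U"
    show "\<exists>z\<in>F \<union> N. dist x z \<le> max (dist x u) (dist x v)"
    proof (cases "u \<in> N \<or> v \<in> N")
      case True
      then show ?thesis by (metis UnI2 max.cobounded1 max.cobounded2)
    next
      case False
      then have "dist q u \<le> t - w" "t + w \<le> dist q v" using uv w(1) by (auto simp: U_def N_def)
      then show ?thesis using sphere_net_separates[OF net] w(1) unfolding separates_def by fastforce
    qed
  qed
  moreover have "r \<le> card U"
  proof -
    have "Q \<inter> cball q \<rho> \<subseteq> U" using t(1) by (auto simp: U_def)
    then have "card (Q \<inter> cball q \<rho>) \<le> card U" using Q(1) by (intro card_mono) (auto simp: U_def)
    then show ?thesis using \<rho>(2) by linarith
  qed
  moreover have "card U \<le> \<kappa> ^ 3 * r"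
  proof -
    have "U \<subseteq> Q \<inter> cball q (2 * \<rho>)" using t(2) by (auto simp: U_def)
    then have "card U \<le> card (Q \<inter> cball q (2 * \<rho>))" using Q(1) by (intro card_mono) auto
    then show ?thesis using big by linarith
  qed
  moreover have "2 ^ j * card (F \<union> N) \<le> \<kappa> ^ 3 * r + 2 ^ j * \<kappa> ^ (j + 2)"
  proof -
    have "2 ^ j * card (F \<union> N) \<le> 2 ^ j * card F + 2 ^ j * card N"
      using card_Un_le[of F N] by (simp flip: distrib_left)
    also have "\<dots> \<le> 2 ^ j * \<kappa> ^ (j + 2) + \<kappa> ^ 3 * r" using N F(2) by (intro add_mono) auto
    finally show ?thesis by simp
  qed
  ultimately show ?thesis using F(1) Q(1) by (intro exI[of _ U] exI[of _ "F \<union> N"]) (auto simp: U_def N_def)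
qed

text \<open>The boundary \<open>Y\<close> collects the separator points created by earlier cuts. Each cut discards at
  least \<open>r\<close> points and creates at most \<open>z\<close>, so that there are few cuts and few boundary points.\<close>

lemma iterated_cut:
  fixes P Y :: "'a::metric_space set"
  assumes cut: "\<And>Q::'a set. finite Q \<Longrightarrow> r \<le> card Q \<Longrightarrow>
      \<exists>U Z. U \<subseteq> Q \<and> r \<le> card U \<and> card U \<le> b \<and> finite Z \<and> card Z \<le> z \<and> separates Z U (Q - U)"
    and r: "2 * z \<le> r" "r \<le> b" "0 < r"
    and "finite P" "finite Y"
  shows "\<exists>m Pf Zf. (\<Union>i<m. Pf i) = P \<and> disjoint_family_on Pf {..<m} \<and>
    (\<forall>i<m. card (Pf i) \<le> b \<and> finite (Zf i) \<and> card (Zf i) \<le> b + z \<and> separates (Zf i) (Pf i) ((P - Pf i) \<union> Y)) \<and>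
    r * (\<Sum>i<m. card (Zf i)) \<le> r * card Y + 4 * z * (card P + card Y) \<and>
    r * m \<le> r + 2 * (card P + card Y)"
  using assms(5,6)
proof (induction "card P + card Y" arbitrary: P Y rule: less_induct)
  case less
  show ?case
  proof (cases "r \<le> card (P \<union> Y)")
    case False
    then have "card P \<le> b" "card Y \<le> b"
      using card_mono[of "P \<union> Y" P] card_mono[of "P \<union> Y" Y] less.prems r by auto
    moreover have "separates Y P Y" unfolding separates_def by (metis max.cobounded2)
    ultimately show ?thesis
      using less.prems
      by - (rule exI[of _ 1], rule exI[of _ "\<lambda>_. P"], rule exI[of _ "\<lambda>_. Y"],
        auto simp: disjoint_family_on_def)
  next
    case True
    then obtain U Z where U: "U \<subseteq> P \<union> Y" "r \<le> card U" "card U \<le> b" and Z: "finite Z" "card Z \<le> z"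
      and sep: "separates Z U (P \<union> Y - U)"
      using cut[of "P \<union> Y"] less.prems by auto
    define P' Y' where "P' = P - U" and "Y' = (Y - U) \<union> Z"
    have finU: "finite U" using U(1) less.prems by (meson finite_Un finite_subset)
    have cP: "card P = card P' + card (P \<inter> U)" and cY: "card Y = card (Y - U) + card (Y \<inter> U)"
      using less.prems by (auto simp: P'_def card_Diff_subset_Int card_mono)
    have "card U \<le> card (P \<inter> U) + card (Y \<inter> U)"
      using U(1) less.prems card_Un_le[of "P \<inter> U" "Y \<inter> U"] by (metis Int_Un_distrib2 Int_absorb1)
    then have rU: "r \<le> card (P \<inter> U) + card (Y \<inter> U)" using U(2) by linarith
    have cY': "card Y' \<le> card (Y - U) + z" using card_Un_le[of "Y - U" Z] Z(2) by (simp add: Y'_def)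
    have N: "card P' + card Y' + r \<le> card P + card Y + z" using cP cY rU cY' by linarith
    then have "card P' + card Y' < card P + card Y" using r by linarith
    from less.hyps[OF this] obtain m Pf Zf where
      part: "(\<Union>i<m. Pf i) = P'" "disjoint_family_on Pf {..<m}" and
      reg: "\<And>i. i < m \<Longrightarrow> card (Pf i) \<le> b \<and> finite (Zf i) \<and> card (Zf i) \<le> b + z \<and> separates (Zf i) (Pf i) ((P' - Pf i) \<union> Y')" and
      sumZ: "r * (\<Sum>i<m. card (Zf i)) \<le> r * card Y' + 4 * z * (card P' + card Y')" and
      m: "r * m \<le> r + 2 * (card P' + card Y')"
      using less.prems Z by (auto simp: P'_def Y'_def)
    \<comment> \<open>The claim separates each region from all of \<open>Y\<close> as well, so old
      boundary points inside \<open>U\<close> stay in the boundary of the new region.\<close>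
    let ?Pf = "Pf(m := P \<inter> U)" and ?Zf = "Zf(m := Z \<union> (Y \<inter> U))"
    have sub: "Pf i \<subseteq> P'" if "i < m" for i using part(1) that by blast
    show ?thesis
    proof (rule exI[of _ "Suc m"], rule exI[of _ ?Pf], rule exI[of _ ?Zf], intro conjI allI impI)
      show "(\<Union>i<Suc m. ?Pf i) = P" using part(1) by (auto simp: lessThan_Suc P'_def)
      show "disjoint_family_on ?Pf {..<Suc m}"
        using part(2) sub by (fastforce simp: disjoint_family_on_def P'_def less_Suc_eq)
      show "r * (\<Sum>i<Suc m. card (?Zf i)) \<le> r * card Y + 4 * z * (card P + card Y)"
      proof -
        have c: "card (Z \<union> (Y \<inter> U)) \<le> z + card (Y \<inter> U)" using card_Un_le[of Z "Y \<inter> U"] Z(2) by linarith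
        have "r * (\<Sum>i<Suc m. card (?Zf i)) = r * (\<Sum>i<m. card (Zf i)) + r * card (Z \<union> (Y \<inter> U))"
          by (simp add: algebra_simps)
        also have "\<dots> \<le> r * (card (Y - U) + z) + 4 * z * (card P' + card Y') + r * (z + card (Y \<inter> U))"
          using sumZ mult_le_mono2[OF cY', of r] mult_le_mono2[OF c, of r] by linarith
        finally have 1: "r * (\<Sum>i<Suc m. card (?Zf i)) \<le> r * card Y + 2 * z * r + 4 * z * (card P' + card Y')"
          by (simp add: cY algebra_simps)
        \<comment> \<open>The term \<open>4 * z * (card P + card Y)\<close> acts as a potential. A
          cut lowers it by at least \<open>4 * z * (r - z) \<ge> 2 * z * r\<close>, which pays for
          the two places where the at most \<open>z\<close> new points are counted: in
          \<open>Y'\<close> and in the boundary of the new region.\<close>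
        have "4 * z * (card P' + card Y') + 4 * z * r \<le> 4 * z * (card P + card Y) + 2 * z * (2 * z)"
          using mult_le_mono2[OF N, of "4 * z"] by (simp add: algebra_simps)
        then have "4 * z * (card P' + card Y') + 4 * z * r \<le> 4 * z * (card P + card Y) + 2 * z * r"
          using mult_le_mono2[OF r(1), of "2 * z"] by linarith
        then show ?thesis using 1 by linarith
      qed
      show "r * Suc m \<le> r + 2 * (card P + card Y)"
        using m N r(1) by simp
      fix i assume i: "i < Suc m"
      show "card (?Pf i) \<le> b"
      proof (cases "i = m")
        case True
        have "card (P \<inter> U) \<le> card U" using finU by (intro card_mono) auto
        then show ?thesis using True U(3) by simp
      qed (use reg i in auto)
      show "finite (?Zf i)" using reg i Z less.prems by (auto simp: less_Suc_eq)
      show "card (?Zf i) \<le> b + z"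
      proof (cases "i = m")
        case True
        have "card (Y \<inter> U) \<le> card U" using finU by (intro card_mono) auto
        then show ?thesis using True U(3) card_Un_le[of Z "Y \<inter> U"] Z(2) by simp
      qed (use reg i in auto)
      show "separates (?Zf i) (?Pf i) ((P - ?Pf i) \<union> Y)"
      proof (cases "i = m")
        case True
        have "separates (Z \<union> (Y \<inter> U)) (P \<inter> U) ((P - P \<inter> U) \<union> Y)"
          unfolding separates_def
        proof (intro ballI allI)
          fix u v x assume "u \<in> P \<inter> U" "v \<in> (P - P \<inter> U) \<union> Y"
          then show "\<exists>w\<in>Z \<union> (Y \<inter> U). dist x w \<le> max (dist x u) (dist x v)"
            using sep unfolding separates_def by (metis Diff_iff Int_iff UnCI UnE max.cobounded2)
        qed
        then show ?thesis using True by simp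
      next
        case False
        then have im: "i < m" using i by simp
        have "separates (Zf i) (Pf i) ((P - Pf i) \<union> Y)"
          unfolding separates_def
        proof (intro ballI allI)
          fix u v x assume u: "u \<in> Pf i" and v: "v \<in> (P - Pf i) \<union> Y"
          have s: "\<And>v'. v' \<in> (P' - Pf i) \<union> Y' \<Longrightarrow> \<exists>w\<in>Zf i. dist x w \<le> max (dist x u) (dist x v')"
            using reg[OF im] u unfolding separates_def by blast
          show "\<exists>w\<in>Zf i. dist x w \<le> max (dist x u) (dist x v)"
          proof (cases "v \<in> U")
            case False
            then show ?thesis using s v by (auto simp: P'_def Y'_def)
          next
            case True
            \<comment> \<open>Two-stage crossing: the present cut gives a point \<open>w\<close> of
              \<open>Z\<close> that is near enough. As \<open>w\<close> belongs to
              \<open>Y'\<close>, the induction hypothesis replaces it by a point of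
              \<open>Zf i\<close>. This is why the induction carries \<open>Y\<close>.\<close>
            have "u \<in> P \<union> Y - U" using u sub[OF im] by (auto simp: P'_def)
            then obtain w where w: "w \<in> Z" "dist x w \<le> max (dist x v) (dist x u)"
              using sep True unfolding separates_def by blast
            then obtain w' where "w' \<in> Zf i" "dist x w' \<le> max (dist x u) (dist x w)"
              using s[of w] by (auto simp: Y'_def)
            then show ?thesis using w(2) by (intro bexI[of _ w']) auto
          qed
        qed
        then show ?thesis using False by simp
      qed
    qed
  qed
qed

text \<open>The parameter \<open>j\<close> trades precision for size: the boundary is roughly a
  \<open>2 ^ j\<close>-th part of \<open>P\<close>, at the price of regions of size exponential in
  \<open>j\<close>. The bound on \<open>m\<close> rests on cuts that remove at least
  \<open>r \<ge> 32\<close> points each, of which at most half are replaced by boundary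
  points.\<close>

lemma euclidean_division:
  "\<exists>\<kappa>::nat. 1 \<le> \<kappa> \<and> (\<forall>j (P::'a::euclidean_space set). \<kappa> \<le> 2 ^ j \<longrightarrow> finite P \<longrightarrow>
     (\<exists>m Pf Zf. (\<Union>i<m. Pf i) = P \<and> disjoint_family_on Pf {..<m} \<and>
      (\<forall>i<m. card (Pf i) \<le> \<kappa> ^ (j + 4) \<and> finite (Zf i) \<and> card (Zf i) \<le> \<kappa> ^ (j + 4) \<and> separates (Zf i) (Pf i) (P - Pf i)) \<and>
      2 ^ j * (\<Sum>i<m. card (Zf i)) \<le> \<kappa> * card P \<and> 16 * m \<le> 16 + card P))"
proof -
  obtain k :: nat where k: "1 \<le> k" "\<And>j (c::'a) R. 0 < R \<Longrightarrow>
     \<exists>F. finite F \<and> card F \<le> k ^ j \<and> cball c R \<subseteq> (\<Union>f\<in>F. cball f (R / 2 ^ j))"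
    using cball_power_cover by blast
  show ?thesis
  proof (rule exI[of _ "8 * k ^ 3"], intro conjI allI impI)
    show "1 \<le> 8 * k ^ 3" using k(1) by simp
    fix j :: nat and P :: "'a set" assume j: "8 * k ^ 3 \<le> 2 ^ j" and P: "finite P"
    \<comment> \<open>The density \<open>r\<close> is so large that the net of the sphere, of size
      \<open>k ^ (j + 2)\<close>, costs no more than the share \<open>k ^ 3 * r / 2 ^ j\<close> of
      the sparse annulus; \<open>z\<close> then bounds their sum.\<close>
    define r where "r = (2 * k) ^ (j + 2) * 8"
    define z where "z = (2 * k ^ 3 * r) div 2 ^ j"
    have "(2 * 1) ^ 2 \<le> (2 * k) ^ 2" using k(1) by (intro power_mono) auto
    also have "\<dots> \<le> (2 * k) ^ (j + 2)" using k(1) by (intro power_increasing) auto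
    finally have r: "32 \<le> r" by (simp add: r_def)
    have z: "2 ^ j * z \<le> 2 * k ^ 3 * r" by (simp add: z_def)
    have "2 ^ j * (2 * z) \<le> (2 * 2 * k ^ 3) * r" using z by (simp add: algebra_simps)
    also have "\<dots> \<le> 2 ^ j * r" using j by (intro mult_le_mono) auto
    finally have zr: "2 * z \<le> r" by simp
    have "2 ^ j * k ^ (j + 2) \<le> 2 ^ (j + 2) * k ^ (j + 2)" by (intro mult_le_mono) auto
    also have "\<dots> \<le> k ^ 3 * r" using k(1) by (simp add: r_def power_mult_distrib)
    finally have net: "2 ^ j * k ^ (j + 2) \<le> k ^ 3 * r" .
    have cut: "\<exists>U Z. U \<subseteq> Q \<and> r \<le> card U \<and> card U \<le> k ^ 3 * r \<and> finite Z \<and> card Z \<le> z \<and> separates Z U (Q - U)"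
      if Q: "finite Q" "r \<le> card Q" for Q :: "'a set"
    proof -
      obtain U Z where U: "U \<subseteq> Q" "r \<le> card U" "card U \<le> k ^ 3 * r" "finite Z"
        "2 ^ j * card Z \<le> k ^ 3 * r + 2 ^ j * k ^ (j + 2)" "separates Z U (Q - U)"
        using ball_cut[of k Q r j, OF k(2) Q] r by auto
      then have "card Z * 2 ^ j \<le> 2 * k ^ 3 * r" using net by (simp add: mult.commute)
      then have "card Z \<le> z" by (simp add: z_def less_eq_div_iff_mult_less_eq)
      then show ?thesis using U by blast
    qed
    have "k ^ 3 * r + z \<le> 16 * k ^ 3 * (2 * k) ^ (j + 2)"
    proof -
      have "z \<le> k ^ 3 * r" using zr k(1) by (metis add_leD1 le_trans mult_2 mult_le_mono1 nat_mult_1 one_le_power)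
      then show ?thesis by (simp add: r_def ac_simps)
    qed
    also have "\<dots> \<le> (8 * k ^ 3) ^ 2 * (8 * k ^ 3) ^ (j + 2)"
    proof -
      have "1 \<le> k ^ 3" "k \<le> k ^ 3" using k(1) self_le_power[of k 3] by auto
      then have "16 * k ^ 3 \<le> (8 * k ^ 3)\<^sup>2" "2 * k \<le> 8 * k ^ 3"
        using mult_le_mono[of 16 "8 * (8 * k ^ 3)" "k ^ 3" "k ^ 3"] by (simp_all add: power2_eq_square ac_simps)
      then show ?thesis by (intro mult_le_mono[of "16 * k ^ 3"] power_mono) auto
    qed
    also have "\<dots> = (8 * k ^ 3) ^ (j + 4)"
    proof -
      have e: "j + 4 = 2 + (j + 2)" by simp
      show ?thesis unfolding e power_add ..
    qed
    finally have size: "k ^ 3 * r + z \<le> (8 * k ^ 3) ^ (j + 4)" .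
    obtain m Pf Zf where D: "(\<Union>i<m. Pf i) = P" "disjoint_family_on Pf {..<m}"
      "\<forall>i<m. card (Pf i) \<le> k ^ 3 * r \<and> finite (Zf i) \<and> card (Zf i) \<le> k ^ 3 * r + z \<and> separates (Zf i) (Pf i) ((P - Pf i) \<union> {})"
      "r * (\<Sum>i<m. card (Zf i)) \<le> r * card {} + 4 * z * (card P + card {})"
      "r * m \<le> r + 2 * (card P + card {})"
      using iterated_cut[OF cut zr _ _ P finite.emptyI] r k(1) by auto
    have "r * (2 ^ j * (\<Sum>i<m. card (Zf i))) \<le> 4 * (2 ^ j * z) * card P"
      using D(4) mult_le_mono2[of _ _ "2 ^ j"] by (simp add: algebra_simps)
    also have "\<dots> \<le> 4 * (2 * k ^ 3 * r) * card P" by (rule mult_le_mono1[OF mult_le_mono2[OF z]])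
    finally have "2 ^ j * (\<Sum>i<m. card (Zf i)) \<le> 8 * k ^ 3 * card P" using r by (simp add: algebra_simps)
    moreover have "16 * m \<le> 16 + card P"
    proof (cases m)
      case (Suc m')
      then have "r * m' \<le> 2 * card P" using D(5) by simp
      then have "32 * m' \<le> 2 * card P" using r by (meson le_trans mult_le_mono1)
      then show ?thesis using Suc by simp
    qed simp
    ultimately show "\<exists>m Pf Zf. (\<Union>i<m. Pf i) = P \<and> disjoint_family_on Pf {..<m} \<and>
      (\<forall>i<m. card (Pf i) \<le> (8 * k ^ 3) ^ (j + 4) \<and> finite (Zf i) \<and> card (Zf i) \<le> (8 * k ^ 3) ^ (j + 4) \<and>
        separates (Zf i) (Pf i) (P - Pf i)) \<and>
      2 ^ j * (\<Sum>i<m. card (Zf i)) \<le> 8 * k ^ 3 * card P \<and> 16 * m \<le> 16 + card P"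
      using D(1-3) size by - (rule exI[of _ m], rule exI[of _ Pf], rule exI[of _ Zf], auto intro: order_trans)
  qed
qed

section \<open>Closing centers cheaply\<close>

lemma exists_nearest:
  fixes S :: "'a::metric_space set"
  assumes "finite S" "S \<noteq> {}"
  shows "\<exists>u\<in>S. \<forall>v\<in>S. dist x u \<le> dist x v"
proof -
  have "Min ((\<lambda>u. dist x u) ` S) \<in> (\<lambda>u. dist x u) ` S" using assms by (intro Min_in) auto
  then obtain u where "u \<in> S" "Min ((\<lambda>u. dist x u) ` S) = dist x u" by blast
  then show ?thesis using assms(1) by (metis Min_le finite_imageI imageI)
qed

text \<open>A center \<open>f\<close> of \<open>G\<close> is compared with the clusters of all centers of \<open>L\<close> whose nearest center
  in \<open>G\<close> is \<open>f\<close>. If \<open>f\<close> is not dominant, it can be closed: its clients move via the cheapest crossing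
  client \<open>link f\<close>, which connects \<open>f\<close> to the other center \<open>t f\<close> at distance at most twice the cost of that client.\<close>

locale two_clusterings =
  fixes C L G :: "'a::metric_space set" and l g :: "'a \<Rightarrow> 'a" and \<tau> :: real and p :: nat
  assumes finC: "finite C" and finL: "finite L" and finG: "finite G" and card_eq: "card G = card L"
    and l_in: "\<And>x. x \<in> C \<Longrightarrow> l x \<in> L" and g_in: "\<And>x. x \<in> C \<Longrightarrow> g x \<in> G"
    and \<tau>: "0 < \<tau>" "\<tau> \<le> 1"
begin

definition c where "c x = dist x (l x) + dist x (g x)"
definition \<sigma> where "\<sigma> a = (SOME f. f \<in> G \<and> (\<forall>f'\<in>G. dist a f \<le> dist a f'))"
definition pre where "pre f = {a\<in>L. \<sigma> a = f}"
definition common where "common f = {x\<in>C. \<sigma> (l x) = f \<and> g x = f}"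
definition crossing where "crossing f = {x\<in>C. (\<sigma> (l x) = f) \<noteq> (g x = f)}"
definition dominant where "dominant = {f\<in>G. card (crossing f) < \<tau> * card (common f)}"
definition isolated where "isolated = {f\<in>dominant. card (pre f) = 1}"
definition partner where "partner f = the_elem (pre f)"
definition link where "link f = (SOME y. y \<in> crossing f \<and> (\<forall>y'\<in>crossing f. c y \<le> c y'))"
text \<open>The value \<open>f\<close> for an empty \<open>crossing f\<close> is a fixed point,
  which the independent selection tolerates. It is never the target of a rerouted client, since
  \<open>crossing_nonempty\<close> applies to those.\<close>

definition t where
  "t f = (if crossing f = {} then f else if \<sigma> (l (link f)) = f then g (link f) else \<sigma> (l (link f)))"
definition reassign where
  "reassign S x = (if g x \<notin> S then g x else if \<sigma> (l x) \<notin> S then \<sigma> (l x) else t (\<sigma> (l x)))"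
text \<open>A bound for the extra cost of closing \<open>f\<close>. The factor \<open>8 ^ p\<close>
  is the stretch of a rerouted client. The division by \<open>\<tau>\<close> arises because common
  clients pay for the link, and at a non-dominant center they outnumber the crossing clients at most
  by the factor \<open>1 / \<tau>\<close>.\<close>

definition weight where
  "weight f = 8 ^ p * ((\<Sum>x\<in>{x\<in>C. g x = f}. c x ^ p) + (\<Sum>x\<in>crossing f. c x ^ p) / \<tau>)"

lemma c_nonneg: "0 \<le> c x" by (simp add: c_def)

lemma finite_common: "finite (common f)" and finite_crossing: "finite (crossing f)"
  using finC by (auto simp: common_def crossing_def)

lemma \<sigma>: assumes "G \<noteq> {}" shows "\<sigma> a \<in> G" "\<And>f. f \<in> G \<Longrightarrow> dist a (\<sigma> a) \<le> dist a f"
  using someI_ex[of "\<lambda>f. f \<in> G \<and> (\<forall>f'\<in>G. dist a f \<le> dist a f')"] exists_nearest[OF finG assms, of a]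
  unfolding \<sigma>_def by blast+

lemma dist_l_\<sigma>: assumes "x \<in> C" shows "dist (l x) (\<sigma> (l x)) \<le> c x"
proof -
  have "dist (l x) (\<sigma> (l x)) \<le> dist (l x) (g x)" using \<sigma>(2) g_in[OF assms] by blast
  then show ?thesis using dist_triangle3[of "l x" "g x" x] by (simp add: c_def)
qed

lemma link:
  assumes "crossing f \<noteq> {}"
  shows "link f \<in> crossing f" "\<And>y. y \<in> crossing f \<Longrightarrow> c (link f) \<le> c y"
proof -
  have "\<exists>y. y \<in> crossing f \<and> (\<forall>y'\<in>crossing f. c y \<le> c y')"
    using ex_is_arg_min_if_finite[OF finite_crossing assms, of c] by (auto simp: is_arg_min_linorder)
  from someI_ex[OF this] show "link f \<in> crossing f" "\<And>y. y \<in> crossing f \<Longrightarrow> c (link f) \<le> c y"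
    unfolding link_def by blast+
qed

lemma t_crossing:
  assumes "crossing f \<noteq> {}"
  shows "t f \<in> G" "t f \<noteq> f" "dist f (t f) \<le> 2 * c (link f)"
proof -
  let ?y = "link f"
  have y: "?y \<in> C" "(\<sigma> (l ?y) = f) \<noteq> (g ?y = f)" using link(1)[OF assms] by (auto simp: crossing_def)
  have ne: "G \<noteq> {}" using g_in y(1) by auto
  show "t f \<in> G" "t f \<noteq> f" using assms y g_in \<sigma>(1)[OF ne] by (auto simp: t_def)
  have "dist (\<sigma> (l ?y)) (g ?y) \<le> dist (\<sigma> (l ?y)) (l ?y) + dist (l ?y) ?y + dist ?y (g ?y)"
    by (meson add_mono dist_triangle order_refl order_trans)
  also have "\<dots> \<le> 2 * c ?y" using dist_l_\<sigma>[OF y(1)] by (simp add: c_def dist_commute)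
  finally show "dist f (t f) \<le> 2 * c ?y" using assms y by (auto simp: t_def dist_commute)
qed

text \<open>Since \<open>card G = card L\<close>, centers with at least two preimages under
  \<open>\<sigma>\<close> are at most as many as those with none, and the latter have no common
  clients and are not dominant. A dominant center that is not isolated therefore has at least two
  preimages and is charged to a non-dominant one.\<close>

lemma card_le_non_dominant: "card G \<le> 2 * card (G - dominant) + card isolated"
proof -
  define T0 T2 where "T0 = {f\<in>G. card (pre f) = 0}" and "T2 = {f\<in>G. 2 \<le> card (pre f)}"
  define T1 where "T1 = {f\<in>G. card (pre f) = 1}"
  have finp: "finite (pre f)" for f using finL by (simp add: pre_def)
  have G: "G = T0 \<union> T1 \<union> T2" by (auto simp: T0_def T1_def T2_def)
  have cG: "card G = card T0 + card T1 + card T2"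
    unfolding G using finG by (subst card_Un_disjoint, auto simp: T0_def T1_def T2_def)+
  have "card T1 + 2 * card T2 \<le> (\<Sum>f\<in>T1. card (pre f)) + (\<Sum>f\<in>T2. card (pre f))"
    using sum_mono[of T2 "\<lambda>_. 2" "\<lambda>f. card (pre f)"] by (auto simp: T1_def T2_def)
  also have "\<dots> = (\<Sum>f\<in>T1 \<union> T2. card (pre f))"
    using finG by (subst sum.union_disjoint) (auto simp: T1_def T2_def)
  also have "\<dots> = card (\<Union>f\<in>T1 \<union> T2. pre f)"
    using finG finp by (subst card_UN_disjoint) (auto simp: T1_def T2_def pre_def)
  also have "\<dots> \<le> card L" using finL by (intro card_mono) (auto simp: pre_def)
  finally have T: "card T2 \<le> card T0" using cG card_eq by linarith
  have "common f = {}" if "f \<in> T0" for f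
    using that finp[of f] l_in by (auto simp: T0_def common_def pre_def)
  then have "T0 \<subseteq> G - dominant" by (auto simp: T0_def dominant_def)
  then have "card T0 \<le> card (G - dominant)" using finG by (intro card_mono) auto
  moreover have "G \<subseteq> (G - dominant) \<union> isolated \<union> T2"
  proof
    fix f assume "f \<in> G"
    then have "f \<in> T0 \<or> f \<in> T1 \<or> f \<in> T2" using G by blast
    then show "f \<in> (G - dominant) \<union> isolated \<union> T2"
      using \<open>T0 \<subseteq> G - dominant\<close> by (auto simp: isolated_def T1_def)
  qed
  then have "card G \<le> card ((G - dominant) \<union> isolated \<union> T2)"
    using finG by (intro card_mono) (auto simp: isolated_def dominant_def T2_def)
  then have "card G \<le> card (G - dominant) + card isolated + card T2"
    using card_Un_le[of "(G - dominant) \<union> isolated" T2] card_Un_le[of "G - dominant" isolated] by linarith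
  ultimately show ?thesis using T by linarith
qed

lemma partner:
  assumes "f \<in> isolated"
  shows "\<sigma> (partner f) = f" "\<And>a. a \<in> L \<Longrightarrow> \<sigma> a = f \<longleftrightarrow> a = partner f"
proof -
  obtain a where a: "pre f = {a}" using assms by (auto simp: isolated_def card_1_singleton_iff)
  then have "partner f = a" by (simp add: partner_def)
  then show "\<sigma> (partner f) = f" "\<And>a. a \<in> L \<Longrightarrow> \<sigma> a = f \<longleftrightarrow> a = partner f"
    using a unfolding pre_def by blast+
qed

text \<open>Each common client of an isolated \<open>f\<close> is served by \<open>partner f\<close>
  and by \<open>f\<close>, so its \<open>c x\<close> is at least their distance. Dominance says that
  the crossing clients are fewer than \<open>\<tau>\<close> times these.\<close>

lemma crossing_partner_cost:
  "(\<Sum>f\<in>isolated. card (crossing f) * dist (partner f) f ^ p) \<le> \<tau> * (\<Sum>x\<in>C. c x ^ p)"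
proof -
  have "card (crossing f) * dist (partner f) f ^ p \<le> \<tau> * (\<Sum>x\<in>{x\<in>C. g x = f}. c x ^ p)"
    if f: "f \<in> isolated" for f
  proof -
    have "dist (partner f) f ^ p \<le> c x ^ p" if "x \<in> common f" for x
    proof -
      have "l x = partner f" "g x = f" using that partner(2)[OF f] l_in by (auto simp: common_def)
      then have "dist (partner f) f \<le> c x" using dist_triangle3[of "l x" "g x" x] by (simp add: c_def)
      then show ?thesis by (intro power_mono) auto
    qed
    then have "(\<Sum>x\<in>common f. dist (partner f) f ^ p) \<le> (\<Sum>x\<in>common f. c x ^ p)" by (rule sum_mono)
    also have "\<dots> \<le> (\<Sum>x\<in>{x\<in>C. g x = f}. c x ^ p)"
      using finC c_nonneg by (intro sum_mono2) (auto simp: common_def)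
    finally have "card (common f) * dist (partner f) f ^ p \<le> (\<Sum>x\<in>{x\<in>C. g x = f}. c x ^ p)" by simp
    then have "\<tau> * card (common f) * dist (partner f) f ^ p \<le> \<tau> * (\<Sum>x\<in>{x\<in>C. g x = f}. c x ^ p)"
      using \<tau> by (simp add: mult.assoc)
    moreover have "card (crossing f) * dist (partner f) f ^ p \<le> \<tau> * card (common f) * dist (partner f) f ^ p"
      using f by (intro mult_right_mono) (auto simp: isolated_def dominant_def)
    ultimately show ?thesis by linarith
  qed
  then have "(\<Sum>f\<in>isolated. card (crossing f) * dist (partner f) f ^ p)
      \<le> (\<Sum>f\<in>isolated. \<tau> * (\<Sum>x\<in>{x\<in>C. g x = f}. c x ^ p))" by (rule sum_mono)
  also have "\<dots> \<le> (\<Sum>f\<in>G. \<tau> * (\<Sum>x\<in>{x\<in>C. g x = f}. c x ^ p))"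
    using finG \<tau> c_nonneg
    by (intro sum_mono2) (auto simp: isolated_def dominant_def intro!: mult_nonneg_nonneg sum_nonneg)
  also have "\<dots> = \<tau> * (\<Sum>x\<in>C. c x ^ p)"
    using sum.group[OF finC finG, of g "\<lambda>x. c x ^ p"] g_in by (auto simp: sum_distrib_left[symmetric])
  finally show ?thesis .
qed

text \<open>The factor 3: a client occurs once in a cluster of \<open>g\<close> and crosses at most
  two centers, namely \<open>g x\<close> and \<open>\<sigma> (l x)\<close>; moreover
  \<open>1 \<le> 1 / \<tau>\<close>.\<close>

lemma sum_weight: "sum weight (G - dominant) \<le> 3 * 8 ^ p / \<tau> * (\<Sum>x\<in>C. c x ^ p)"
proof -
  let ?X = "\<Sum>x\<in>C. c x ^ p"
  have nn: "0 \<le> (\<Sum>x\<in>A. c x ^ p)" for A using c_nonneg by (intro sum_nonneg) auto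
  have 1: "(\<Sum>f\<in>G. \<Sum>x\<in>{x\<in>C. g x = f}. c x ^ p) = ?X"
    using sum.group[OF finC finG, of g "\<lambda>x. c x ^ p"] g_in by auto
  have 2: "(\<Sum>f\<in>G. \<Sum>x\<in>{x\<in>C. \<sigma> (l x) = f}. c x ^ p) = ?X"
  proof (cases "C = {}")
    case False
    then have "G \<noteq> {}" using g_in by auto
    then show ?thesis using sum.group[OF finC finG, of "\<lambda>x. \<sigma> (l x)" "\<lambda>x. c x ^ p"] \<sigma>(1) by auto
  qed simp
  have "(\<Sum>x\<in>crossing f. c x ^ p) \<le> (\<Sum>x\<in>{x\<in>C. \<sigma> (l x) = f} \<union> {x\<in>C. g x = f}. c x ^ p)" for f
    using finC c_nonneg by (intro sum_mono2) (auto simp: crossing_def)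
  also have "\<dots> f \<le> (\<Sum>x\<in>{x\<in>C. \<sigma> (l x) = f}. c x ^ p) + (\<Sum>x\<in>{x\<in>C. g x = f}. c x ^ p)" for f
    using finC nn[of "{x\<in>C. \<sigma> (l x) = f} \<inter> {x\<in>C. g x = f}"] by (subst sum_Un) auto
  finally have "(\<Sum>f\<in>G. \<Sum>x\<in>crossing f. c x ^ p) \<le> 2 * ?X"
    using sum_mono[of G "\<lambda>f. \<Sum>x\<in>crossing f. c x ^ p"
      "\<lambda>f. (\<Sum>x\<in>{x\<in>C. \<sigma> (l x) = f}. c x ^ p) + (\<Sum>x\<in>{x\<in>C. g x = f}. c x ^ p)"] 1 2
    by (simp add: sum.distrib)
  then have 3: "(\<Sum>f\<in>G. (\<Sum>x\<in>crossing f. c x ^ p) / \<tau>) \<le> 2 * ?X / \<tau>"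
    using \<tau> by (simp add: sum_divide_distrib[symmetric] divide_right_mono)
  have "sum weight (G - dominant) \<le> sum weight G"
    using finG nn \<tau> by (intro sum_mono2) (auto simp: weight_def)
  also have "\<dots> = 8 ^ p * (?X + (\<Sum>f\<in>G. (\<Sum>x\<in>crossing f. c x ^ p) / \<tau>))"
    unfolding weight_def sum_distrib_left[symmetric] sum.distrib 1 ..
  also have "\<dots> \<le> 8 ^ p * (?X / \<tau> + 2 * ?X / \<tau>)"
    using 3 \<tau> nn[of C] by (intro mult_left_mono add_mono) (auto simp: pos_le_divide_eq mult_left_le)
  also have "\<dots> = 3 * 8 ^ p / \<tau> * ?X" by (simp add: field_simps)
  finally show ?thesis .
qed

section \<open>Rerouting the clients of closed centers\<close>

context
  fixes S assumes S: "S \<subseteq> G - dominant" and indep: "\<forall>f\<in>S. t f \<in> S \<longrightarrow> t f = f"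
begin

lemma crossing_nonempty:
  assumes "x \<in> C" "\<sigma> (l x) \<in> S"
  shows "crossing (\<sigma> (l x)) \<noteq> {}"
proof (cases "g x = \<sigma> (l x)")
  case True
  then have "x \<in> common (\<sigma> (l x))" using assms by (simp add: common_def)
  then have "0 < card (common (\<sigma> (l x)))" using finite_common card_gt_0_iff by blast
  moreover have "\<tau> * card (common (\<sigma> (l x))) \<le> card (crossing (\<sigma> (l x)))"
    using assms S by (auto simp: dominant_def not_less)
  ultimately show ?thesis using \<tau> by (auto simp: mult_le_0_iff)
next
  case False
  then show ?thesis using assms by (auto simp: crossing_def)
qed

lemma reassign_in: assumes "x \<in> C" shows "reassign S x \<in> G - S"
proof -
  have "G \<noteq> {}" using g_in assms by auto
  then show ?thesis
    using g_in[OF assms] \<sigma>(1) t_crossing[OF crossing_nonempty[OF assms]] indep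
    by (auto simp: reassign_def)
qed

text \<open>If \<open>\<sigma> (l x)\<close> differs from \<open>g x\<close>, then \<open>x\<close>
  itself crosses \<open>\<sigma> (l x)\<close>, so the cheapest crossing client costs at most
  \<open>c x\<close>. Only common clients pay for a link beyond their own cost.\<close>

lemma reassign_dist:
  assumes x: "x \<in> C" and gx: "g x \<in> S"
  shows "dist x (reassign S x) ^ p \<le> 8 ^ p * (c x ^ p + (if x \<in> common (g x) then c (link (g x)) ^ p else 0))"
proof -
  have 1: "dist x (\<sigma> (l x)) \<le> 2 * c x"
  proof -
    have "dist x (l x) \<le> c x" by (simp add: c_def)
    then show ?thesis using dist_triangle[of x "\<sigma> (l x)" "l x"] dist_l_\<sigma>[OF x] by linarith
  qed
  define y where "y = (if x \<in> common (g x) then c (link (g x)) else 0)"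
  have y0: "0 \<le> y" using c_nonneg by (simp add: y_def)
  have "dist x (reassign S x) \<le> 4 * c x + 2 * y"
  proof (cases "\<sigma> (l x) \<in> S")
    case False
    then show ?thesis using 1 gx y0 c_nonneg[of x] by (simp add: reassign_def)
  next
    case True
    note ne = crossing_nonempty[OF x True]
    have "dist x (t (\<sigma> (l x))) \<le> 2 * c x + 2 * c (link (\<sigma> (l x)))"
      using dist_triangle[of x "t (\<sigma> (l x))" "\<sigma> (l x)"] 1 t_crossing(3)[OF ne] by linarith
    moreover have "c (link (\<sigma> (l x))) \<le> c x + y"
    proof (cases "g x = \<sigma> (l x)")
      case True
      then show ?thesis using x c_nonneg by (auto simp: y_def common_def)
    next
      case False
      then have "c (link (\<sigma> (l x))) \<le> c x" using x by (intro link(2)[OF ne]) (auto simp: crossing_def)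
      then show ?thesis using y0 by linarith
    qed
    ultimately show ?thesis using True gx by (simp add: reassign_def)
  qed
  also have "\<dots> \<le> 8 * max (c x) y" using y0 c_nonneg[of x] by (simp add: max_def)
  finally have "dist x (reassign S x) ^ p \<le> (8 * max (c x) y) ^ p" by (intro power_mono) auto
  also have "\<dots> = 8 ^ p * max (c x) y ^ p" by (simp add: power_mult_distrib)
  also have "\<dots> \<le> 8 ^ p * (c x ^ p + (if x \<in> common (g x) then c (link (g x)) ^ p else 0))"
  proof (intro mult_left_mono)
    show "max (c x) y ^ p \<le> c x ^ p + (if x \<in> common (g x) then c (link (g x)) ^ p else 0)"
    proof (cases "c x \<le> y \<and> x \<in> common (g x)")
      case True
      then show ?thesis using c_nonneg[of x] c_nonneg[of "link (g x)"] by (simp add: max_def y_def)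
    next
      case False
      then have "max (c x) y = c x" using c_nonneg[of x] by (auto simp: max_def y_def)
      then show ?thesis using c_nonneg[of "link (g x)"] by simp
    qed
  qed simp
  finally show ?thesis .
qed

lemma reassign_cost:
  "(\<Sum>x\<in>C. dist x (reassign S x) ^ p) \<le> (\<Sum>x\<in>C. dist x (g x) ^ p) + sum weight S"
proof -
  have finS: "finite S" using S finG finite_subset by blast
  have link_cost: "card (common f) * c (link f) ^ p \<le> (\<Sum>x\<in>crossing f. c x ^ p) / \<tau>" if f: "f \<in> S" for f
  proof (cases "common f = {}")
    case True
    then show ?thesis using \<tau> c_nonneg by (simp add: sum_nonneg)
  next
    case False
    then obtain x where "x \<in> common f" by blast
    then have ne: "crossing f \<noteq> {}" using crossing_nonempty[of x] f by (auto simp: common_def)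
    have "card (crossing f) * c (link f) ^ p = (\<Sum>x\<in>crossing f. c (link f) ^ p)" by simp
    also have "\<dots> \<le> (\<Sum>x\<in>crossing f. c x ^ p)"
      using link(2)[OF ne] c_nonneg by (intro sum_mono power_mono) auto
    finally have "card (crossing f) * c (link f) ^ p \<le> (\<Sum>x\<in>crossing f. c x ^ p)" .
    moreover have "\<tau> * card (common f) * c (link f) ^ p \<le> card (crossing f) * c (link f) ^ p"
      using f S c_nonneg by (intro mult_right_mono) (auto simp: dominant_def not_less)
    ultimately show ?thesis using \<tau> by (simp add: pos_le_divide_eq algebra_simps)
  qed
  have "(\<Sum>x\<in>C. dist x (reassign S x) ^ p)
      \<le> (\<Sum>x\<in>C. dist x (g x) ^ p + (if g x \<in> S then 8 ^ p * (c x ^ p + (if x \<in> common (g x) then c (link (g x)) ^ p else 0)) else 0))"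
  proof (intro sum_mono)
    fix x assume x: "x \<in> C"
    show "dist x (reassign S x) ^ p \<le> dist x (g x) ^ p +
        (if g x \<in> S then 8 ^ p * (c x ^ p + (if x \<in> common (g x) then c (link (g x)) ^ p else 0)) else 0)"
    proof (cases "g x \<in> S")
      case True
      then show ?thesis using reassign_dist[OF x True] by (simp add: add_increasing)
    qed (simp add: reassign_def)
  qed
  also have "\<dots> = (\<Sum>x\<in>C. dist x (g x) ^ p) + (\<Sum>x\<in>{x\<in>C. g x \<in> S}. 8 ^ p * (c x ^ p + (if x \<in> common (g x) then c (link (g x)) ^ p else 0)))"
    by (simp add: sum.distrib sum.inter_filter finC)
  also have "(\<Sum>x\<in>{x\<in>C. g x \<in> S}. 8 ^ p * (c x ^ p + (if x \<in> common (g x) then c (link (g x)) ^ p else 0)))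
      = (\<Sum>f\<in>S. \<Sum>x\<in>{x\<in>C. g x = f}. 8 ^ p * (c x ^ p + (if x \<in> common f then c (link f) ^ p else 0)))"
  proof -
    have "{x \<in> {x\<in>C. g x \<in> S}. g x = f} = {x\<in>C. g x = f}" if "f \<in> S" for f using that by auto
    then show ?thesis
      using finC finS
      by (subst sum.group[of "{x\<in>C. g x \<in> S}" S g, symmetric]) (auto intro!: sum.cong)
  qed
  also have "\<dots> \<le> sum weight S"
  proof (intro sum_mono)
    fix f assume f: "f \<in> S"
    have "(\<Sum>x\<in>{x\<in>C. g x = f}. if x \<in> common f then c (link f) ^ p else 0) = card (common f) * c (link f) ^ p"
    proof -
      have "{x \<in> {x\<in>C. g x = f}. x \<in> common f} = common f" by (auto simp: common_def)
      then show ?thesis using finC by (subst sum.inter_filter[symmetric]) auto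
    qed
    then show "(\<Sum>x\<in>{x\<in>C. g x = f}. 8 ^ p * (c x ^ p + (if x \<in> common f then c (link f) ^ p else 0))) \<le> weight f"
      using link_cost[OF f] by (simp add: weight_def sum_distrib_left[symmetric] sum.distrib)
  qed
  finally show ?thesis by simp
qed

lemma crossing_reassign:
  assumes f: "f \<in> isolated - t ` S"
  shows "{x\<in>C. (l x = partner f) \<noteq> (reassign S x = f)} \<subseteq> crossing f"
proof
  fix x assume x: "x \<in> {x\<in>C. (l x = partner f) \<noteq> (reassign S x = f)}"
  have fS: "f \<notin> S" using f S by (auto simp: isolated_def)
  have "\<sigma> (l x) = f \<longleftrightarrow> l x = partner f" using x f partner(2)[of f "l x"] l_in[of x] by blast
  then have ne: "(\<sigma> (l x) = f) \<noteq> (reassign S x = f)" using x by blast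
  have "(\<sigma> (l x) = f) \<noteq> (g x = f)"
  proof (cases "g x \<in> S")
    case True
    then have "g x \<noteq> f" using fS by blast
    moreover have "\<sigma> (l x) = f"
    proof (rule ccontr)
      assume neq: "\<sigma> (l x) \<noteq> f"
      then have "reassign S x = f" using ne by blast
      then have "\<sigma> (l x) \<in> S" "t (\<sigma> (l x)) = f" using True neq by (auto simp: reassign_def split: if_splits)
      then show False using f by blast
    qed
    ultimately show ?thesis by blast
  qed (use ne in \<open>simp add: reassign_def\<close>)
  then show "x \<in> crossing f" using x by (simp add: crossing_def)
qed

end

text \<open>Closing the cheapest \<open>\<nu>\<close>-fraction of the non-dominant centers costs at
  most that fraction of their total weight. The last conjunct says that the closed centers amount to
  a fixed fraction of the centers outside \<open>I\<close>, unless the latter are boundedly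
  many.\<close>

lemma close_centers:
  fixes \<nu> :: real
  assumes \<nu>: "0 < \<nu>" "\<nu> \<le> 1"
  shows "\<exists>S I \<pi> h. S \<subseteq> G \<and> I \<subseteq> G - S \<and> inj_on \<pi> I \<and> \<pi> ` I \<subseteq> l ` C \<and> (\<forall>x\<in>C. h x \<in> G - S) \<and>
    (\<Sum>x\<in>C. dist x (h x) ^ p) \<le> (\<Sum>x\<in>C. dist x (g x) ^ p) + \<nu> * (3 * 8 ^ p / \<tau>) * (\<Sum>x\<in>C. c x ^ p) \<and>
    (\<Sum>f\<in>I. card {x\<in>C. (l x = \<pi> f) \<noteq> (h x = f)} * dist (\<pi> f) f ^ p) \<le> \<tau> * (\<Sum>x\<in>C. c x ^ p) \<and>
    (\<nu> * (real (card G) - real (card I)) \<le> 24 * card S \<or> \<nu> * (real (card G) - real (card I)) \<le> 2)"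
proof -
  define K where "K = G - dominant"
  have finK: "finite K" using finG by (simp add: K_def)
  define m where "m = nat \<lfloor>\<nu> * card K\<rfloor>"
  have m: "m \<le> \<nu> * card K" using \<nu> by (simp add: m_def)
  moreover have "\<nu> * card K \<le> 1 * real (card K)" using \<nu> by (intro mult_right_mono) auto
  ultimately have "m \<le> card K" by linarith
  then obtain K' where K': "K' \<subseteq> K" "card K' = m" "card K * sum weight K' \<le> m * sum weight K"
    using cheap_subset[OF finK, of m weight] by blast
  have finK': "finite K'" using K'(1) finK finite_subset by blast
  obtain S where S: "S \<subseteq> K'" "card K' \<le> 3 * card S" "\<forall>f\<in>S. t f \<in> S \<longrightarrow> t f = f"
    using independent_subset_of_map[OF finK', of t] by blast
  have finS: "finite S" using S(1) finK' finite_subset by blast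
  have SG: "S \<subseteq> G - dominant" using S(1) K'(1) by (auto simp: K_def)
  have wnn: "0 \<le> weight f" for f
    using \<tau> c_nonneg by (auto simp: weight_def intro!: mult_nonneg_nonneg add_nonneg_nonneg divide_nonneg_nonneg sum_nonneg)
  have "sum weight S \<le> sum weight K'" using S(1) finK' wnn by (intro sum_mono2) auto
  also have "\<dots> \<le> \<nu> * sum weight K"
  proof (cases "card K = 0")
    case True
    then show ?thesis using finK K'(1) by simp
  next
    case False
    have "card K * sum weight K' \<le> (\<nu> * card K) * sum weight K"
      using K'(3) m mult_right_mono[OF m, of "sum weight K"] sum_nonneg[of K weight] wnn by fastforce
    then show ?thesis using False by (simp add: mult.assoc mult.left_commute[of \<nu>])
  qed
  also have "\<dots> \<le> \<nu> * (3 * 8 ^ p / \<tau> * (\<Sum>x\<in>C. c x ^ p))"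
    using sum_weight \<nu> by (intro mult_left_mono) (auto simp: K_def)
  finally have wS: "sum weight S \<le> \<nu> * (3 * 8 ^ p / \<tau>) * (\<Sum>x\<in>C. c x ^ p)" by (simp add: mult.assoc)
  define I where "I = isolated - t ` S"
  have finI: "finite isolated" using finG by (auto simp: isolated_def dominant_def)
  have "card isolated \<le> card I + card S"
    using diff_card_le_card_Diff[of "t ` S" isolated] card_image_le[OF finS, of t] finS by (simp add: I_def)
  then have "card G \<le> 2 * card K + card I + card S" using card_le_non_dominant by (simp add: K_def)
  then have gap: "real (card G) - card I \<le> 2 * card K + card S" by linarith
  have "\<nu> * (real (card G) - real (card I)) \<le> 24 * card S \<or> \<nu> * (real (card G) - real (card I)) \<le> 2"
  \<comment> \<open>Rounding down loses a factor 2 and independence a factor 3, so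
    \<open>\<nu> * card K \<le> 6 * card S\<close>. In the other case \<open>m\<close> is 0 and
    nothing is closed.\<close>
  proof (cases "1 \<le> \<nu> * card K")
    case True
    then have "1 \<le> \<lfloor>\<nu> * card K\<rfloor>" by (simp add: le_floor_iff)
    then have "real m = of_int \<lfloor>\<nu> * card K\<rfloor>" "(1::real) \<le> of_int \<lfloor>\<nu> * card K\<rfloor>" by (auto simp: m_def)
    then have "\<nu> * card K \<le> 2 * real m" using real_of_int_floor_add_one_gt[of "\<nu> * card K"] by linarith
    then have "\<nu> * card K \<le> 6 * card S" using S(2) K'(2) by linarith
    moreover have "\<nu> * card S \<le> 1 * real (card S)" using \<nu> by (intro mult_right_mono) auto
    moreover have "\<nu> * (real (card G) - card I) \<le> 2 * (\<nu> * card K) + \<nu> * card S"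
      using mult_left_mono[OF gap, of \<nu>] \<nu> by (simp add: algebra_simps)
    ultimately show ?thesis by linarith
  next
    case False
    then have "m = 0" using m by linarith
    then have "S = {}" using K'(2) S(1) finK' by auto
    then have "\<nu> * (real (card G) - card I) \<le> 2 * (\<nu> * card K)"
      using mult_left_mono[OF gap, of \<nu>] \<nu> by (simp add: algebra_simps)
    then show ?thesis using False by linarith
  qed
  moreover have "(\<Sum>f\<in>I. card {x\<in>C. (l x = partner f) \<noteq> (reassign S x = f)} * dist (partner f) f ^ p)
      \<le> \<tau> * (\<Sum>x\<in>C. c x ^ p)"
  proof -
    have "(\<Sum>f\<in>I. card {x\<in>C. (l x = partner f) \<noteq> (reassign S x = f)} * dist (partner f) f ^ p)
        \<le> (\<Sum>f\<in>I. card (crossing f) * dist (partner f) f ^ p)"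
      using crossing_reassign[OF SG S(3)] finite_crossing
      by (intro sum_mono mult_right_mono) (auto simp: I_def intro!: card_mono)
    also have "\<dots> \<le> (\<Sum>f\<in>isolated. card (crossing f) * dist (partner f) f ^ p)"
      using finI by (intro sum_mono2) (auto simp: I_def)
    also note crossing_partner_cost
    finally show ?thesis .
  qed
  moreover have "I \<subseteq> G - S" using SG by (auto simp: I_def isolated_def dominant_def)
  moreover have "inj_on partner I" by (rule inj_on_inverseI[of _ \<sigma>]) (use partner(1) in \<open>auto simp: I_def\<close>)
  \<comment> \<open>Each partner really serves a client, because a dominant center has a common
    client. When \<open>L\<close> is a padded set, the partners thus lie in the original
    one.\<close>
  moreover have "partner ` I \<subseteq> l ` C"
  proof
    fix a assume "a \<in> partner ` I"
    then obtain f where f: "a = partner f" "f \<in> isolated" by (auto simp: I_def)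
    then have "common f \<noteq> {}" by (auto simp: isolated_def dominant_def)
    then obtain x where "x \<in> C" "\<sigma> (l x) = f" by (auto simp: common_def)
    then have "l x = a" using partner(2)[OF f(2), of "l x"] l_in[of x] f(1) by simp
    then show "a \<in> l ` C" using \<open>x \<in> C\<close> by blast
  qed
  moreover have "(\<Sum>x\<in>C. dist x (reassign S x) ^ p) \<le> (\<Sum>x\<in>C. dist x (g x) ^ p) + \<nu> * (3 * 8 ^ p / \<tau>) * (\<Sum>x\<in>C. c x ^ p)"
    using reassign_cost[OF SG S(3)] wS by linarith
  moreover have "\<forall>x\<in>C. reassign S x \<in> G - S" using reassign_in[OF SG S(3)] by blast
  ultimately show ?thesis
    using SG by - (rule exI[of _ S], rule exI[of _ I], rule exI[of _ partner], rule exI[of _ "reassign S"], blast)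
qed

end

section \<open>Costs of swaps\<close>

lemma one_plus_power_le:
  fixes t :: real
  assumes "0 \<le> t" "t \<le> 1"
  shows "(1 + t) ^ p \<le> 1 + (2 ^ p - 1) * t"
proof (induction p)
  case (Suc p)
  have a: "(1::real) \<le> 2 ^ p" by simp
  have "(1 + t) ^ Suc p \<le> (1 + (2 ^ p - 1) * t) * (1 + t)"
    using Suc assms by (simp add: mult.commute mult_right_mono)
  also have "\<dots> = 1 + 2 ^ p * t + (2 ^ p - 1) * (t * t)" by (simp add: algebra_simps)
  also have "\<dots> \<le> 1 + 2 ^ p * t + (2 ^ p - 1) * t"
    using assms a by (intro add_mono mult_left_mono) (auto simp: mult_left_le)
  also have "\<dots> = 1 + (2 ^ Suc p - 1) * t" by (simp add: algebra_simps)
  finally show ?case .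
qed simp

text \<open>If \<open>d\<close> is below \<open>\<theta> / 2 ^ p\<close> times \<open>u\<close>, the
  increase is absorbed by the factor \<open>1 + \<theta>\<close>; otherwise \<open>u\<close> is
  bounded by a multiple of \<open>d\<close>.\<close>

lemma power_add_le_weighted:
  fixes u d \<theta> :: real
  assumes "0 \<le> u" "0 \<le> d" "0 < \<theta>" "\<theta> \<le> 1"
  shows "(u + d) ^ p \<le> (1 + \<theta>) * u ^ p + (2 ^ (p + 1) / \<theta>) ^ p * d ^ p"
proof (cases "d \<le> \<theta> / 2 ^ p * u")
  case True
  have t: "0 \<le> \<theta> / 2 ^ p" "\<theta> / 2 ^ p \<le> 1"
    using assms by (auto simp: divide_le_eq intro: order_trans[of _ 1])
  have "(u + d) ^ p \<le> ((1 + \<theta> / 2 ^ p) * u) ^ p"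
    using True assms by (intro power_mono) (auto simp: algebra_simps)
  also have "\<dots> = (1 + \<theta> / 2 ^ p) ^ p * u ^ p" by (rule power_mult_distrib)
  also have "\<dots> \<le> (1 + \<theta>) * u ^ p"
  proof (intro mult_right_mono)
    have "(1 + \<theta> / 2 ^ p) ^ p \<le> 1 + (2 ^ p - 1) * (\<theta> / 2 ^ p)" by (rule one_plus_power_le[OF t])
    also have "\<dots> \<le> 1 + 2 ^ p * (\<theta> / 2 ^ p)" using t by (intro add_left_mono mult_right_mono) auto
    finally show "(1 + \<theta> / 2 ^ p) ^ p \<le> 1 + \<theta>" by simp
  qed (use assms in auto)
  also have "\<dots> \<le> (1 + \<theta>) * u ^ p + (2 ^ (p + 1) / \<theta>) ^ p * d ^ p" using assms by simp
  finally show ?thesis .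
next
  case False
  have "1 \<le> 2 ^ p / \<theta>" using assms by (simp add: le_divide_eq) (meson one_le_numeral one_le_power order_trans)
  then have "d \<le> 2 ^ p / \<theta> * d" using assms by (metis mult_right_mono mult_1)
  moreover have "u \<le> 2 ^ p / \<theta> * d" using False assms by (simp add: field_simps)
  ultimately have "u + d \<le> 2 ^ (p + 1) / \<theta> * d" by simp
  then have "(u + d) ^ p \<le> (2 ^ (p + 1) / \<theta> * d) ^ p" using assms by (intro power_mono) auto
  also have "\<dots> = (2 ^ (p + 1) / \<theta>) ^ p * d ^ p" by (rule power_mult_distrib)
  also have "\<dots> \<le> (1 + \<theta>) * u ^ p + (2 ^ (p + 1) / \<theta>) ^ p * d ^ p" using assms by simp
  finally show ?thesis .
qed

lemma power_add_le_double:
  fixes a b :: real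
  assumes "0 \<le> a" "0 \<le> b"
  shows "(a + b) ^ p \<le> 2 ^ p * (a ^ p + b ^ p)"
proof -
  have "(a + b) ^ p \<le> (2 * max a b) ^ p" using assms by (intro power_mono) auto
  also have "\<dots> = 2 ^ p * max a b ^ p" by (rule power_mult_distrib)
  also have "\<dots> \<le> 2 ^ p * (a ^ p + b ^ p)" using assms by (intro mult_left_mono) (auto simp: max_def)
  finally show ?thesis .
qed

lemma clustering_cost_le:
  assumes "finite S" "\<And>x. x \<in> C \<Longrightarrow> \<exists>u\<in>S. dist x u ^ p \<le> v x"
  shows "clustering_cost p C S \<le> sum v C"
  unfolding clustering_cost_def
proof (rule sum_mono)
  fix x assume "x \<in> C"
  then obtain u where u: "u \<in> S" "dist x u ^ p \<le> v x" using assms(2) by blast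
  have "(MIN u\<in>S. dist x u) \<le> dist x u" using u(1) assms(1) by simp
  moreover have "0 \<le> (MIN u\<in>S. dist x u)" using u(1) assms(1) by (subst Min_ge_iff) auto
  ultimately have "(MIN u\<in>S. dist x u) ^ p \<le> dist x u ^ p" by (intro power_mono) auto
  then show "(MIN u\<in>S. dist x u) ^ p \<le> v x" using u(2) by linarith
qed

lemma clustering_cost_attained:
  assumes "finite S" "S \<noteq> {}"
  shows "\<exists>l. (\<forall>x. l x \<in> S) \<and> clustering_cost p C S = (\<Sum>x\<in>C. dist x (l x) ^ p)"
proof -
  have "\<exists>u. u \<in> S \<and> (MIN u\<in>S. dist x u) = dist x u" for x
  proof -
    have "(MIN u\<in>S. dist x u) \<in> (\<lambda>u. dist x u) ` S" using assms by (intro Min_in) auto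
    then show ?thesis by blast
  qed
  then obtain l where "\<And>x. l x \<in> S \<and> (MIN u\<in>S. dist x u) = dist x (l x)" by metis
  then show ?thesis unfolding clustering_cost_def by (intro exI[of _ l]) auto
qed

lemma clustering_cost_nonneg: "finite S \<Longrightarrow> S \<noteq> {} \<Longrightarrow> 0 \<le> clustering_cost p C S"
  using clustering_cost_attained[of S p C] by (auto intro!: sum_nonneg)

lemma clustering_cost_antimono:
  assumes "finite T" "S \<subseteq> T" "S \<noteq> {}"
  shows "clustering_cost p C T \<le> clustering_cost p C S"
proof -
  have "finite S" using assms finite_subset by blast
  then obtain l where l: "\<And>x. l x \<in> S" "clustering_cost p C S = (\<Sum>x\<in>C. dist x (l x) ^ p)"
    using clustering_cost_attained[of S p C] assms(3) by blast
  show ?thesis unfolding l(2) using l(1) assms by (intro clustering_cost_le) auto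
qed

text \<open>A client gains when the center \<open>h x\<close> is opened and can only lose when \<open>l x\<close> is closed. In the
  latter swap it loses at most the difference of the two costs, up to \<open>e x\<close>, so that the two swaps
  together replace the cost of \<open>l x\<close> by that of \<open>h x\<close>.\<close>

lemma sum_swap_costs_le:
  fixes C L :: "'a::metric_space set" and J :: "('a set \<times> 'a set) set"
  assumes fin: "finite C" "finite L" "finite J" "\<And>j. j \<in> J \<Longrightarrow> finite (snd j)"
    and l: "\<And>x. x \<in> C \<Longrightarrow> l x \<in> L"
    and disj: "\<And>i j. i \<in> J \<Longrightarrow> j \<in> J \<Longrightarrow> i \<noteq> j \<Longrightarrow> fst i \<inter> fst j = {}"
    and opened: "\<And>x. x \<in> C \<Longrightarrow> \<exists>j\<in>J. h x \<in> snd j"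
    and closed: "\<And>x j. x \<in> C \<Longrightarrow> j \<in> J \<Longrightarrow> l x \<in> fst j \<Longrightarrow>
      \<exists>u\<in>(L - fst j) \<union> snd j. dist x u ^ p \<le> max (dist x (l x) ^ p) (dist x (h x) ^ p) + e x"
    and e: "\<And>x. x \<in> C \<Longrightarrow> 0 \<le> e x"
  shows "(\<Sum>j\<in>J. clustering_cost p C ((L - fst j) \<union> snd j)) \<le>
    card J * (\<Sum>x\<in>C. dist x (l x) ^ p) + (\<Sum>x\<in>C. dist x (h x) ^ p) - (\<Sum>x\<in>C. dist x (l x) ^ p) + sum e C"
proof -
  define a b where "a x = dist x (l x) ^ p" and "b x = dist x (h x) ^ p" for x
  obtain i where i: "\<And>x. x \<in> C \<Longrightarrow> i x \<in> J \<and> h x \<in> snd (i x)" using opened by metis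
  \<comment> \<open>The swap \<open>i x\<close> is credited with the gain
    \<open>min (b x - a x) 0\<close>, and the only swap closing \<open>l x\<close> with the loss
    \<open>max (b x - a x) 0\<close>. The two add up to \<open>b x - a x\<close>. Other swaps that
    open \<open>h x\<close> are not credited.\<close>
  define v where "v j x = a x + (if j = i x then min (b x - a x) 0 else 0)
      + (if l x \<in> fst j then max (b x - a x) 0 + e x else 0)" for j x
  have "clustering_cost p C ((L - fst j) \<union> snd j) \<le> sum (v j) C" if j: "j \<in> J" for j
  proof (rule clustering_cost_le)
    show "finite ((L - fst j) \<union> snd j)" using fin j by auto
    fix x assume x: "x \<in> C"
    consider "j = i x" "b x \<le> a x" | "l x \<notin> fst j" "j \<noteq> i x \<or> a x \<le> b x" | "l x \<in> fst j" "j \<noteq> i x \<or> a x \<le> b x"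
      by linarith
    then show "\<exists>u\<in>(L - fst j) \<union> snd j. dist x u ^ p \<le> v j x"
    proof cases
      case 1
      then show ?thesis using i[OF x] e[OF x] by (intro bexI[of _ "h x"]) (auto simp: v_def b_def)
    next
      case 2
      then show ?thesis using l[OF x] by (intro bexI[of _ "l x"]) (auto simp: v_def a_def)
    next
      case 3
      then obtain u where "u \<in> (L - fst j) \<union> snd j" "dist x u ^ p \<le> max (a x) (b x) + e x"
        using closed[OF x j] by (auto simp: a_def b_def)
      then show ?thesis using 3 by (intro bexI[of _ u]) (auto simp: v_def max_def)
    qed
  qed
  then have "(\<Sum>j\<in>J. clustering_cost p C ((L - fst j) \<union> snd j)) \<le> (\<Sum>j\<in>J. sum (v j) C)" by (rule sum_mono)
  also have "\<dots> = (\<Sum>x\<in>C. \<Sum>j\<in>J. v j x)" by (rule sum.swap)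
  also have "\<dots> \<le> (\<Sum>x\<in>C. card J * a x + b x - a x + e x)"
  proof (rule sum_mono)
    fix x assume x: "x \<in> C"
    have one: "(\<Sum>j\<in>J. if l x \<in> fst j then max (b x - a x) 0 + e x else 0) \<le> max (b x - a x) 0 + e x"
    proof (cases "\<exists>j\<in>J. l x \<in> fst j")
      case True
      then obtain j0 where j0: "j0 \<in> J" "l x \<in> fst j0" by blast
      then have "(l x \<in> fst j) = (j = j0)" if "j \<in> J" for j using disj[of j j0] that by blast
      then have "(\<Sum>j\<in>J. if l x \<in> fst j then max (b x - a x) 0 + e x else 0)
        = (\<Sum>j\<in>J. if j = j0 then max (b x - a x) 0 + e x else 0)" by (intro sum.cong) auto
      also have "\<dots> = max (b x - a x) 0 + e x" using fin(3) j0(1) by simp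
      finally show ?thesis by simp
    next
      case False
      then have "(\<Sum>j\<in>J. if l x \<in> fst j then max (b x - a x) 0 + e x else 0) = 0" by (intro sum.neutral) auto
      then show ?thesis using e[OF x] by simp
    qed
    have "(\<Sum>j\<in>J. if j = i x then min (b x - a x) 0 else 0) = min (b x - a x) 0"
      using fin(3) i[OF x] by simp
    then have "(\<Sum>j\<in>J. v j x) \<le> card J * a x + min (b x - a x) 0 + (max (b x - a x) 0 + e x)"
      using one by (simp add: v_def sum.distrib)
    then show "(\<Sum>j\<in>J. v j x) \<le> card J * a x + b x - a x + e x" by (auto simp: min_def max_def split: if_splits)
  qed
  also have "\<dots> = card J * sum a C + sum b C - sum a C + sum e C"
    by (simp add: sum.distrib sum_subtractf sum_distrib_left)
  finally show ?thesis by (simp add: a_def b_def)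
qed

section \<open>Families of swaps with disjoint closed parts\<close>

definition swap_family :: "'a::metric_space set \<Rightarrow> 'a set \<Rightarrow> nat \<Rightarrow> ('a set \<times> 'a set) set \<Rightarrow> bool" where
  "swap_family L G b J \<longleftrightarrow> finite J \<and> (\<forall>i\<in>J. \<forall>j\<in>J. i \<noteq> j \<longrightarrow> fst i \<inter> fst j = {}) \<and> G \<subseteq> (\<Union>j\<in>J. snd j) \<and>
    (\<forall>j\<in>J. fst j \<subseteq> L \<and> finite (snd j) \<and> card (snd j) \<le> card (fst j) \<and> card (fst j) \<le> b)"

text \<open>A single region may contain more points of \<open>G\<close> and \<open>Z\<close> than of
  \<open>L\<close>. Grouping regions by \<open>balanced_partition\<close> evens this out with
  boundedly many regions per swap. A center of \<open>G\<close> outside a group lies outside each of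
  its regions, so the separators of the regions suffice.\<close>

lemma separated_swap_family:
  fixes L G :: "'a::metric_space set"
  assumes fin: "finite L" "finite G"
    and part: "(\<Union>i<m. Pf i) = L \<union> G" "disjoint_family_on Pf {..<m}"
    and reg: "\<And>i. i < m \<Longrightarrow> card (Pf i) \<le> b \<and> finite (Zf i) \<and> card (Zf i) \<le> b \<and> separates (Zf i) (Pf i) (L \<union> G - Pf i)"
    and slack: "card G + (\<Sum>i<m. card (Zf i)) \<le> card L"
  shows "\<exists>J. swap_family L G ((4 * b + 1) * b) J \<and> card J \<le> m \<and> (\<forall>j\<in>J. separates (snd j) (fst j) (G - snd j))"
proof -
  have finP: "finite (Pf i)" if "i < m" for i
    using part(1) fin that by (metis UN_upper finite_Un finite_subset lessThan_iff)
  have disj: "Pf i \<inter> Pf j = {}" if "i < m" "j < m" "i \<noteq> j" for i j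
    using part(2) that by (auto simp: disjoint_family_on_def)
  have card_part: "(\<Sum>i\<in>I. card (X \<inter> Pf i)) = card (X \<inter> (\<Union>i\<in>I. Pf i))" if "I \<subseteq> {..<m}" for I X
  proof -
    have "finite I" using that finite_subset by blast
    then have "card (\<Union>i\<in>I. X \<inter> Pf i) = (\<Sum>i\<in>I. card (X \<inter> Pf i))"
    proof (intro card_UN_disjoint ballI impI)
      fix i assume "i \<in> I"
      then have "i < m" using that by blast
      then show "finite (X \<inter> Pf i)" using finP by blast
      fix j assume "j \<in> I" "i \<noteq> j"
      then show "X \<inter> Pf i \<inter> (X \<inter> Pf j) = {}" using disj[of i j] \<open>i < m\<close> that by blast
    qed
    then show ?thesis by (simp only: Int_UN_distrib)
  qed
  \<comment> \<open>The surplus of closed over opened centers in region \<open>i\<close>. Each of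
    the three cardinalities is at most \<open>b\<close>, hence the bound \<open>2 * b\<close>;
    \<open>slack\<close> makes the total nonnegative.\<close>
  define d where "d i = int (card (L \<inter> Pf i)) - int (card (G \<inter> Pf i)) - int (card (Zf i))" for i
  have le_b: "card (X \<inter> Pf i) \<le> b" if "i < m" for i X
    using card_mono[OF finP[OF that], of "X \<inter> Pf i"] reg[OF that] by fastforce
  have sumd: "sum d I = int (card (L \<inter> (\<Union>i\<in>I. Pf i))) - int (card (G \<inter> (\<Union>i\<in>I. Pf i))) - int (\<Sum>i\<in>I. card (Zf i))"
    if "I \<subseteq> {..<m}" for I
    using card_part[OF that, of L] card_part[OF that, of G] unfolding d_def
    by (simp add: sum_subtractf flip: of_nat_sum)
  have "\<bar>d i\<bar> \<le> int (2 * b)" if "i \<in> {..<m}" for i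
    using le_b[of i L] le_b[of i G] reg[of i] that by (auto simp: d_def)
  moreover have "0 \<le> sum d {..<m}"
  proof -
    have "sum d {..<m} = int (card L) - int (card G) - int (\<Sum>i<m. card (Zf i))"
      using sumd[of "{..<m}"] part(1) by (simp add: Int_absorb2 del: of_nat_sum)
    then show ?thesis using slack by linarith
  qed
  ultimately obtain \<J> where \<J>: "finite \<J>" "\<Union>\<J> = {..<m}" "disjoint \<J>" "card \<J> \<le> m"
    "\<And>I. I \<in> \<J> \<Longrightarrow> card I \<le> 2 * (2 * b) + 1 \<and> 0 \<le> sum d I"
    using balanced_partition[of "{..<m}" d "2 * b"] by auto
  define sw where "sw I = (L \<inter> (\<Union>i\<in>I. Pf i), (G \<inter> (\<Union>i\<in>I. Pf i)) \<union> (\<Union>i\<in>I. Zf i))" for I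
  have sub: "I \<subseteq> {..<m}" if "I \<in> \<J>" for I using \<J>(2) that by blast
  have fam: "finite (snd (sw I)) \<and> card (snd (sw I)) \<le> card (fst (sw I)) \<and> card (fst (sw I)) \<le> (4 * b + 1) * b \<and>
      separates (snd (sw I)) (fst (sw I)) (G - snd (sw I))" if I: "I \<in> \<J>" for I
  proof (intro conjI)
    have finI: "finite I" using sub[OF I] finite_subset by blast
    show "finite (snd (sw I))" using fin finI reg sub[OF I] by (auto simp: sw_def)
    have "card (snd (sw I)) \<le> card (G \<inter> (\<Union>i\<in>I. Pf i)) + card (\<Union>i\<in>I. Zf i)"
      unfolding sw_def by (simp add: card_Un_le)
    also have "card (\<Union>i\<in>I. Zf i) \<le> (\<Sum>i\<in>I. card (Zf i))" using finI by (rule card_UN_le)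
    finally show "card (snd (sw I)) \<le> card (fst (sw I))"
      using sumd[OF sub[OF I]] \<J>(5)[OF I] unfolding sw_def fst_conv snd_conv by linarith
    have "card (fst (sw I)) = (\<Sum>i\<in>I. card (L \<inter> Pf i))" using card_part[OF sub[OF I]] by (simp add: sw_def)
    also have "\<dots> \<le> card I * b" using le_b sub[OF I] sum_bounded_above[of I "\<lambda>i. card (L \<inter> Pf i)" b] by auto
    also have "\<dots> \<le> (4 * b + 1) * b" using \<J>(5)[OF I] by (intro mult_le_mono1) auto
    finally show "card (fst (sw I)) \<le> (4 * b + 1) * b" .
    show "separates (snd (sw I)) (fst (sw I)) (G - snd (sw I))"
      unfolding separates_def
    proof (intro ballI allI)
      fix u v x assume u: "u \<in> fst (sw I)" and v: "v \<in> G - snd (sw I)"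
      obtain i where i: "i \<in> I" "u \<in> Pf i" using u by (auto simp: sw_def)
      have "v \<in> L \<union> G - Pf i" using v i by (auto simp: sw_def)
      then obtain z where "z \<in> Zf i" "dist x z \<le> max (dist x u) (dist x v)"
        using reg[of i] sub[OF I] i unfolding separates_def by blast
      then show "\<exists>z\<in>snd (sw I). dist x z \<le> max (dist x u) (dist x v)" using i by (auto simp: sw_def)
    qed
  qed
  have "swap_family L G ((4 * b + 1) * b) (sw ` \<J>)"
    unfolding swap_family_def
  proof (intro conjI ballI impI)
    show "finite (sw ` \<J>)" using \<J>(1) by simp
    show "G \<subseteq> (\<Union>j\<in>sw ` \<J>. snd j)"
    proof
      fix f assume f: "f \<in> G"
      then obtain i where i: "i < m" "f \<in> Pf i" using part(1) by blast
      then obtain I where "I \<in> \<J>" "i \<in> I" using \<J>(2) by blast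
      then show "f \<in> (\<Union>j\<in>sw ` \<J>. snd j)" using f i by (auto simp: sw_def)
    qed
    fix j assume "j \<in> sw ` \<J>"
    then obtain I where I: "j = sw I" "I \<in> \<J>" by blast
    show "fst j \<subseteq> L" using I by (simp add: sw_def)
    show "finite (snd j)" "card (snd j) \<le> card (fst j)" "card (fst j) \<le> (4 * b + 1) * b" using fam I by auto
    fix j' assume "j' \<in> sw ` \<J>" "j \<noteq> j'"
    then obtain I' where I': "j' = sw I'" "I' \<in> \<J>" "I \<noteq> I'" using I by blast
    then have "I \<inter> I' = {}" using \<J>(3) I by (auto simp: disjoint_def)
    then have "Pf i \<inter> Pf i' = {}" if "i \<in> I" "i' \<in> I'" for i i'
      using disj[of i i'] that sub[OF I(2)] sub[OF I'(2)] by blast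
    then show "fst j \<inter> fst j' = {}" unfolding I(1) I'(1) sw_def fst_conv by blast
  qed
  moreover have "card (sw ` \<J>) \<le> m" using card_image_le[OF \<J>(1), of sw] \<J>(4) by linarith
  ultimately show ?thesis using fam by blast
qed

lemma swap_family_Un:
  assumes "swap_family L G b J" "swap_family L' G' b' J'" "L \<inter> L' = {}"
  shows "swap_family (L \<union> L') (G \<union> G') (max b b') (J \<union> J')"
  unfolding swap_family_def
proof (intro conjI ballI impI)
  note a = assms(1)[unfolded swap_family_def] and a' = assms(2)[unfolded swap_family_def]
  show "finite (J \<union> J')" "G \<union> G' \<subseteq> (\<Union>j\<in>J \<union> J'. snd j)" using a a' by auto
  fix i assume i: "i \<in> J \<union> J'"
  then show "fst i \<subseteq> L \<union> L'" "finite (snd i)" "card (snd i) \<le> card (fst i)" "card (fst i) \<le> max b b'"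
    using a a' by (auto intro: order_trans[OF _ max.cobounded1] order_trans[OF _ max.cobounded2])
  fix j assume j: "j \<in> J \<union> J'" "i \<noteq> j"
  have sub: "fst j \<subseteq> L" if "j \<in> J" for j using a that by blast
  have sub': "fst j \<subseteq> L'" if "j \<in> J'" for j using a' that by blast
  show "fst i \<inter> fst j = {}"
  proof (cases "i \<in> J \<and> j \<in> J \<or> i \<in> J' \<and> j \<in> J'")
    case True
    then show ?thesis using a a' j by blast
  next
    case False
    then have "i \<in> J \<and> j \<in> J' \<or> i \<in> J' \<and> j \<in> J" using i j by blast
    then show ?thesis using assms(3) sub[of i] sub[of j] sub'[of i] sub'[of j] by blast
  qed
qed

text \<open>Exchanging one pair at a time would need as many swaps as pairs, too many for the loss
  tolerated by the stopping rule.\<close>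

lemma paired_swap_family:
  fixes I :: "'a::metric_space set"
  assumes "finite I" "inj_on \<pi> I"
  shows "\<exists>J. swap_family (\<pi> ` I) I 16 J \<and> 16 * card J \<le> 16 + card I \<and> (\<forall>j\<in>J. snd j \<subseteq> I \<and> fst j = \<pi> ` snd j)"
proof -
  obtain \<J> where \<J>: "finite \<J>" "\<Union>\<J> = I" "disjoint \<J>" "card \<J> \<le> card I div 16 + 1" "\<And>K. K \<in> \<J> \<Longrightarrow> card K \<le> 16"
    using chunk_partition[OF assms(1), of 16] by auto
  let ?J = "(\<lambda>K. (\<pi> ` K, K)) ` \<J>"
  have sub: "K \<subseteq> I" if "K \<in> \<J>" for K using \<J>(2) that by blast
  have card: "card (\<pi> ` K) = card K" if "K \<in> \<J>" for K
    using assms(2) sub[OF that] by (meson card_image inj_on_subset)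
  have disj: "\<pi> ` K \<inter> \<pi> ` K' = {}" if "K \<in> \<J>" "K' \<in> \<J>" "K \<noteq> K'" for K K'
  proof -
    have "\<pi> ` K \<inter> \<pi> ` K' = \<pi> ` (K \<inter> K')"
      using inj_on_image_Int[OF assms(2) sub[OF that(1)] sub[OF that(2)]] by simp
    also have "K \<inter> K' = {}" using \<J>(3) that by (auto simp: disjoint_def)
    finally show ?thesis by simp
  qed
  have "swap_family (\<pi> ` I) I 16 ?J"
    unfolding swap_family_def
  proof (intro conjI ballI impI)
    show "finite ?J" using \<J>(1) by simp
    show "I \<subseteq> (\<Union>j\<in>?J. snd j)" using \<J>(2) by auto
    fix j assume "j \<in> ?J"
    then obtain K where K: "j = (\<pi> ` K, K)" "K \<in> \<J>" by blast
    show "fst j \<subseteq> \<pi> ` I" "finite (snd j)" "card (snd j) \<le> card (fst j)" "card (fst j) \<le> 16"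
      using K sub[OF K(2)] card[OF K(2)] \<J>(5)[OF K(2)] assms(1) by (auto intro: finite_subset)
    fix j' assume "j' \<in> ?J" "j \<noteq> j'"
    then obtain K' where "j' = (\<pi> ` K', K')" "K' \<in> \<J>" "K \<noteq> K'" using K by blast
    then show "fst j \<inter> fst j' = {}" using K disj by simp
  qed
  moreover have "16 * card ?J \<le> 16 + card I" using card_image_le[OF \<J>(1), of "\<lambda>K. (\<pi> ` K, K)"] \<J>(4) by linarith
  ultimately show ?thesis using sub by (intro exI[of _ ?J]) auto
qed

text \<open>Clients that lose \<open>l x\<close> in a swap of \<open>J1\<close> use a separator when
  \<open>h x\<close> is an unopened center of \<open>G\<close> outside \<open>I\<close>. For
  \<open>h x\<close> in \<open>I\<close> they use \<open>\<pi> (h x)\<close>, which stays open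
  because \<open>J1\<close> closes only centers of \<open>L\<close>. In a swap of \<open>J2\<close>
  closing \<open>l x = \<pi> f\<close>, they move to \<open>f\<close>. Moves across a pair occur
  only at a mismatch and are charged to the weighted error term. The same argument yields an open
  center for any client, hence the first claim.\<close>

lemma sum_swap_costs_paired_le:
  fixes C S L G I :: "'a::metric_space set"
  assumes fin: "finite C" "finite S" "finite I"
    and lh: "\<And>x. x \<in> C \<Longrightarrow> l x \<in> S" "\<And>x. x \<in> C \<Longrightarrow> h x \<in> G \<union> I"
    and J1: "swap_family L G n J1" "\<And>j. j \<in> J1 \<Longrightarrow> separates (snd j) (fst j) (G - snd j)"
    and J2: "swap_family (\<pi> ` I) I b' J2" "\<And>j. j \<in> J2 \<Longrightarrow> snd j \<subseteq> I \<and> fst j = \<pi> ` snd j"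
    and \<pi>: "L \<inter> \<pi> ` I = {}" "\<pi> ` I \<subseteq> S"
    and \<theta>: "0 < \<theta>" "\<theta> \<le> 1"
  shows "C \<noteq> {} \<Longrightarrow> j \<in> J1 \<union> J2 \<Longrightarrow> (S - fst j) \<union> snd j \<noteq> {}"
    and "(\<Sum>j\<in>J1 \<union> J2. clustering_cost p C ((S - fst j) \<union> snd j)) \<le>
    card (J1 \<union> J2) * (\<Sum>x\<in>C. dist x (l x) ^ p) + (\<Sum>x\<in>C. dist x (h x) ^ p) - (\<Sum>x\<in>C. dist x (l x) ^ p)
    + (\<theta> * ((\<Sum>x\<in>C. dist x (l x) ^ p) + (\<Sum>x\<in>C. dist x (h x) ^ p))
    + (2 ^ (p + 1) / \<theta>) ^ p * (\<Sum>f\<in>I. card {x\<in>C. (l x = \<pi> f) \<noteq> (h x = f)} * dist (\<pi> f) f ^ p))"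
proof -
  define a b where "a x = dist x (l x) ^ p" and "b x = dist x (h x) ^ p" for x
  define K where "K = (2 ^ (p + 1) / \<theta>) ^ p"
  define D where "D f x = (if (l x = \<pi> f) \<noteq> (h x = f) then dist (\<pi> f) f ^ p else 0)" for f x
  define e where "e x = \<theta> * (a x + b x) + K * (\<Sum>f\<in>I. D f x)" for x
  have nn: "0 \<le> a x" "0 \<le> b x" "0 \<le> K" "0 \<le> D f x" for x f
    using \<theta> by (auto simp: a_def b_def K_def D_def)
  then have e0: "0 \<le> e x" for x
    using \<theta> unfolding e_def by (intro add_nonneg_nonneg mult_nonneg_nonneg sum_nonneg) auto
  have U: "swap_family (L \<union> \<pi> ` I) (G \<union> I) (max n b') (J1 \<union> J2)"
    using swap_family_Un[OF J1(1) J2(1) \<pi>(1)] .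
  have bump: "dist x u ^ p \<le> max (a x) (b x) + e x"
    if "f \<in> I" "(l x = \<pi> f) \<noteq> (h x = f)" "v = l x \<or> v = h x" "dist x u \<le> dist x v + dist (\<pi> f) f" for x u v f
  proof -
    have "dist x u ^ p \<le> (dist x v + dist (\<pi> f) f) ^ p" using that(4) by (intro power_mono) auto
    also have "\<dots> \<le> (1 + \<theta>) * dist x v ^ p + K * dist (\<pi> f) f ^ p"
      unfolding K_def using \<theta> by (intro power_add_le_weighted) auto
    also have "dist (\<pi> f) f ^ p = D f x" using that(2) by (simp add: D_def)
    also have "D f x \<le> (\<Sum>f\<in>I. D f x)" using that(1) fin(3) nn(4) by (intro member_le_sum) auto
    also have "(1 + \<theta>) * dist x v ^ p \<le> max (a x) (b x) + \<theta> * (a x + b x)"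
    proof -
      have v: "dist x v ^ p \<le> max (a x) (b x)" "dist x v ^ p \<le> a x + b x"
        using that(3) nn(1,2)[of x] by (auto simp: a_def b_def)
      then have "\<theta> * dist x v ^ p \<le> \<theta> * (a x + b x)" using \<theta> by (intro mult_left_mono) auto
      then show ?thesis using v(1) by (simp add: algebra_simps)
    qed
    finally show ?thesis using nn(3) by (simp add: e_def mult_left_mono)
  qed
  have closed: "\<exists>u\<in>(S - fst j) \<union> snd j. dist x u ^ p \<le> max (dist x (l x) ^ p) (dist x (h x) ^ p) + e x"
    if x: "x \<in> C" and j: "j \<in> J1 \<union> J2" and lx: "l x \<in> fst j" for x j
  proof (cases "h x \<in> snd j")
    case True
    then show ?thesis using e0[of x] by (intro bexI[of _ "h x"]) auto
  next
    case hx: False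
    show ?thesis
    proof (cases "j \<in> J1")
      case True
      then have jL: "fst j \<subseteq> L" using J1(1) by (auto simp: swap_family_def)
      show ?thesis
      proof (cases "h x \<in> I")
        case hI: True
        have "dist x (\<pi> (h x)) \<le> dist x (h x) + dist (\<pi> (h x)) (h x)"
          using dist_triangle[of x "\<pi> (h x)" "h x"] by (simp add: dist_commute)
        moreover have "l x \<noteq> \<pi> (h x)" using lx jL \<pi>(1) hI by blast
        ultimately have "dist x (\<pi> (h x)) ^ p \<le> max (a x) (b x) + e x"
          using bump[of "h x" x "h x" "\<pi> (h x)"] hI by blast
        moreover have "\<pi> (h x) \<in> S - fst j" using jL \<pi> hI by blast
        ultimately show ?thesis unfolding a_def b_def by blast
      next
        case False
        then have "h x \<in> G - snd j" using lh(2)[OF x] hx by blast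
        then obtain z where z: "z \<in> snd j" "dist x z \<le> max (dist x (l x)) (dist x (h x))"
          using J1(2)[OF True] lx unfolding separates_def by blast
        have "dist x z ^ p \<le> max (dist x (l x)) (dist x (h x)) ^ p" using z(2) by (intro power_mono) auto
        also have "\<dots> \<le> max (a x) (b x)" by (auto simp: max_def a_def b_def power_mono)
        finally show ?thesis using z(1) e0[of x] unfolding a_def b_def by (intro bexI[of _ z]) auto
      qed
    next
      case False
      then have j2: "snd j \<subseteq> I" "fst j = \<pi> ` snd j" using j J2(2) by auto
      then obtain f where f: "f \<in> snd j" "l x = \<pi> f" using lx by blast
      have "dist x f \<le> dist x (l x) + dist (\<pi> f) f" using dist_triangle[of x f "l x"] f(2) by simp
      moreover have "h x \<noteq> f" using f hx by blast
      ultimately have "dist x f ^ p \<le> max (a x) (b x) + e x"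
        using bump[of f x "l x" f] f j2 by blast
      then show ?thesis using f(1) unfolding a_def b_def by blast
    qed
  qed
  have "(\<Sum>j\<in>J1 \<union> J2. clustering_cost p C ((S - fst j) \<union> snd j)) \<le>
      card (J1 \<union> J2) * (\<Sum>x\<in>C. dist x (l x) ^ p) + (\<Sum>x\<in>C. dist x (h x) ^ p) - (\<Sum>x\<in>C. dist x (l x) ^ p) + sum e C"
  proof (rule sum_swap_costs_le)
    show "finite C" "finite S" using fin by auto
    show "finite (J1 \<union> J2)" using J1(1) J2(1) by (auto simp: swap_family_def)
    fix x assume x: "x \<in> C"
    show "l x \<in> S" "0 \<le> e x" using lh x e0 by auto
    show "\<exists>j\<in>J1 \<union> J2. h x \<in> snd j" using U lh(2)[OF x] by (auto simp: swap_family_def)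
  qed (use U closed in \<open>auto simp: swap_family_def\<close>)
  also have "sum e C = \<theta> * (sum a C + sum b C) + K * (\<Sum>f\<in>I. card {x\<in>C. (l x = \<pi> f) \<noteq> (h x = f)} * dist (\<pi> f) f ^ p)"
  proof -
    have "(\<Sum>x\<in>C. \<Sum>f\<in>I. D f x) = (\<Sum>f\<in>I. \<Sum>x\<in>C. D f x)" by (rule sum.swap)
    also have "\<dots> = (\<Sum>f\<in>I. card {x\<in>C. (l x = \<pi> f) \<noteq> (h x = f)} * dist (\<pi> f) f ^ p)"
      unfolding D_def by (intro sum.cong refl) (simp add: sum.inter_filter[symmetric] fin(1) del: not_iff)
    finally show ?thesis by (simp add: e_def sum.distrib sum_distrib_left[symmetric])
  qed
  finally show "(\<Sum>j\<in>J1 \<union> J2. clustering_cost p C ((S - fst j) \<union> snd j)) \<le>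
    card (J1 \<union> J2) * (\<Sum>x\<in>C. dist x (l x) ^ p) + (\<Sum>x\<in>C. dist x (h x) ^ p) - (\<Sum>x\<in>C. dist x (l x) ^ p)
    + (\<theta> * ((\<Sum>x\<in>C. dist x (l x) ^ p) + (\<Sum>x\<in>C. dist x (h x) ^ p))
    + (2 ^ (p + 1) / \<theta>) ^ p * (\<Sum>f\<in>I. card {x\<in>C. (l x = \<pi> f) \<noteq> (h x = f)} * dist (\<pi> f) f ^ p))"
    by (simp add: a_def b_def K_def)
  assume "C \<noteq> {}" "j \<in> J1 \<union> J2"
  then obtain x where "x \<in> C" by blast
  then show "(S - fst j) \<union> snd j \<noteq> {}"
    using closed[OF _ \<open>j \<in> J1 \<union> J2\<close>] lh(1) by (cases "l x \<in> fst j") blast+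
qed

section \<open>Local optima\<close>

text \<open>If the slack \<open>s\<close> is a fixed fraction of \<open>card L\<close>, a division
  fine enough keeps the total boundary below \<open>s\<close>. Otherwise \<open>L\<close> is bounded
  and can be exchanged for \<open>G\<close> in one swap.\<close>

lemma slack_swap_family:
  "\<exists>\<kappa>::nat. 1 \<le> \<kappa> \<and> (\<forall>N s (L::'a::euclidean_space set) G. finite L \<longrightarrow> finite G \<longrightarrow> card G + s = card L \<longrightarrow>
     card L \<le> 24 * 2 ^ N * s \<or> card L \<le> 2 * 2 ^ N \<longrightarrow>
     (\<exists>J. swap_family L G (2 ^ (3 + 2 * \<kappa> * (N + 10 + \<kappa>))) J \<and> 16 * card J \<le> 16 + 2 * card L \<and>
       (\<forall>j\<in>J. separates (snd j) (fst j) (G - snd j))))"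
proof -
  obtain \<kappa> :: nat where \<kappa>: "1 \<le> \<kappa>" and div: "\<And>j (P::'a set). \<kappa> \<le> 2 ^ j \<Longrightarrow> finite P \<Longrightarrow>
     \<exists>m Pf Zf. (\<Union>i<m. Pf i) = P \<and> disjoint_family_on Pf {..<m} \<and>
      (\<forall>i<m. card (Pf i) \<le> \<kappa> ^ (j + 4) \<and> finite (Zf i) \<and> card (Zf i) \<le> \<kappa> ^ (j + 4) \<and> separates (Zf i) (Pf i) (P - Pf i)) \<and>
      2 ^ j * (\<Sum>i<m. card (Zf i)) \<le> \<kappa> * card P \<and> 16 * m \<le> 16 + card P"
    using euclidean_division by blast
  have \<kappa>2: "\<kappa> \<le> 2 ^ \<kappa>" by (simp add: less_imp_le)
  show ?thesis
  proof (rule exI[of _ \<kappa>], intro conjI allI impI)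
    show "1 \<le> \<kappa>" by (rule \<kappa>)
    fix N s :: nat and L G :: "'a set"
    assume fin: "finite L" "finite G" and s: "card G + s = card L"
      and "card L \<le> 24 * 2 ^ N * s \<or> card L \<le> 2 * 2 ^ N"
    define B where "B = (2::nat) ^ (3 + 2 * \<kappa> * (N + 10 + \<kappa>))"
    from \<open>card L \<le> 24 * 2 ^ N * s \<or> card L \<le> 2 * 2 ^ N\<close>
    have "\<exists>J. swap_family L G B J \<and> 16 * card J \<le> 16 + 2 * card L \<and> (\<forall>j\<in>J. separates (snd j) (fst j) (G - snd j))"
    proof
      assume small: "card L \<le> 2 * 2 ^ N"
      have "1 * N \<le> 2 * \<kappa> * (N + 10 + \<kappa>)" using \<kappa> by (intro mult_le_mono) auto
      then have "2 ^ (1 + N) \<le> B" unfolding B_def by (intro power_increasing) auto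
      then have "swap_family L G B {(L, G)}" using small fin s by (auto simp: swap_family_def)
      then show ?thesis by (intro exI[of _ "{(L, G)}"]) (auto simp: separates_def)
    next
      assume large: "card L \<le> 24 * 2 ^ N * s"
      \<comment> \<open>The boundary has at most \<open>\<kappa> * 2 * card L / 2 ^ j\<close>
        points. The summand \<open>\<kappa>\<close> absorbs the factor
        \<open>\<kappa> \<le> 2 ^ \<kappa>\<close>, and 6 absorbs
        \<open>48 \<le> 2 ^ 6\<close>.\<close>
      define j where "j = N + 6 + \<kappa>"
      have "(2::nat) ^ \<kappa> \<le> 2 ^ j" by (intro power_increasing) (auto simp: j_def)
      then have "\<kappa> \<le> 2 ^ j" using \<kappa>2 by linarith
      then obtain m Pf Zf where D: "(\<Union>i<m. Pf i) = L \<union> G" "disjoint_family_on Pf {..<m}"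
        "\<And>i. i < m \<Longrightarrow> card (Pf i) \<le> \<kappa> ^ (j + 4) \<and> finite (Zf i) \<and> card (Zf i) \<le> \<kappa> ^ (j + 4) \<and> separates (Zf i) (Pf i) (L \<union> G - Pf i)"
        "2 ^ j * (\<Sum>i<m. card (Zf i)) \<le> \<kappa> * card (L \<union> G)" "16 * m \<le> 16 + card (L \<union> G)"
        using div[of j "L \<union> G"] fin by (metis finite_Un)
      have c2: "card (L \<union> G) \<le> 2 * card L" using card_Un_le[of L G] s by linarith
      have "2 ^ j * (\<Sum>i<m. card (Zf i)) \<le> \<kappa> * (2 * card L)" using D(4) mult_le_mono2[OF c2, of \<kappa>] by linarith
      also have "\<dots> \<le> 2 ^ \<kappa> * (2 * (24 * 2 ^ N * s))" using \<kappa>2 large by (intro mult_le_mono) auto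
      also have "\<dots> \<le> 2 ^ j * s" by (simp add: j_def power_add)
      finally have "(\<Sum>i<m. card (Zf i)) \<le> s" by simp
      then have "card G + (\<Sum>i<m. card (Zf i)) \<le> card L" using s by linarith
      from separated_swap_family[OF fin D(1,2,3) this] obtain J where
        J: "swap_family L G ((4 * \<kappa> ^ (j + 4) + 1) * \<kappa> ^ (j + 4)) J" "card J \<le> m"
          "\<forall>j\<in>J. separates (snd j) (fst j) (G - snd j)" by blast
      have "(4 * \<kappa> ^ (j + 4) + 1) * \<kappa> ^ (j + 4) \<le> B"
      proof -
        have "\<kappa> ^ (j + 4) \<le> (2 ^ \<kappa>) ^ (j + 4)" using \<kappa>2 by (intro power_mono) auto
        also have "\<dots> = 2 ^ (\<kappa> * (j + 4))" by (rule power_mult[symmetric])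
        finally have b: "\<kappa> ^ (j + 4) \<le> 2 ^ (\<kappa> * (j + 4))" .
        have "(4 * \<kappa> ^ (j + 4) + 1) * \<kappa> ^ (j + 4) \<le> (8 * 2 ^ (\<kappa> * (j + 4))) * 2 ^ (\<kappa> * (j + 4))"
        proof (intro mult_le_mono b)
          show "4 * \<kappa> ^ (j + 4) + 1 \<le> 8 * 2 ^ (\<kappa> * (j + 4))"
            using b one_le_power[of "2::nat" "\<kappa> * (j + 4)"] by linarith
        qed
        also have "\<dots> = 2 ^ (3 + (\<kappa> * (j + 4) + \<kappa> * (j + 4)))" by (simp only: power_add) simp
        also have "3 + (\<kappa> * (j + 4) + \<kappa> * (j + 4)) = 3 + 2 * \<kappa> * (N + 10 + \<kappa>)" by (simp add: j_def algebra_simps)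
        finally show ?thesis unfolding B_def .
      qed
      then have "swap_family L G B J" using J(1) unfolding swap_family_def by (meson order_trans)
      moreover have "16 * card J \<le> 16 + 2 * card L" using J(2) D(5) c2 by linarith
      ultimately show ?thesis using J(3) by blast
    qed
    then show "\<exists>J. swap_family L G (2 ^ (3 + 2 * \<kappa> * (N + 10 + \<kappa>))) J \<and> 16 * card J \<le> 16 + 2 * card L \<and>
       (\<forall>j\<in>J. separates (snd j) (fst j) (G - snd j))" unfolding B_def .
  qed
qed

lemma superset_of_card:
  assumes "infinite (UNIV :: 'a set)" "finite S" "card S \<le> k"
  shows "\<exists>L::'a set. S \<subseteq> L \<and> finite L \<and> card L = k"
proof -
  have "infinite (- S)" using assms by (simp add: Compl_eq_Diff_UNIV)
  then obtain B where B: "finite B" "card B = k - card S" "B \<subseteq> - S"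
    using infinite_arbitrarily_large by blast
  then have "card (S \<union> B) = k" using assms by (subst card_Un_disjoint) auto
  then show ?thesis using B(1) assms(2) by (intro exI[of _ "S \<union> B"]) auto
qed

lemma infinite_UNIV_euclidean: "infinite (UNIV :: 'a::euclidean_space set)"
  using finite_imp_bounded not_bounded_UNIV by blast

text \<open>The exponent \<open>b\<close> depends only on \<open>p\<close> and the space, so with
  \<open>2 ^ q\<close> comparable to \<open>1 / \<epsilon>\<close> the swap size is polynomial in
  \<open>1 / \<epsilon>\<close>.\<close>

lemma test_swaps:
  "\<exists>b\<ge>4. \<forall>q k (C::'a::euclidean_space set) S T. finite C \<longrightarrow> C \<noteq> {} \<longrightarrow> centers k S \<longrightarrow> centers k T \<longrightarrow>
     (\<exists>J. finite J \<and> 8 * card J \<le> 16 + k \<and>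
       (\<forall>j\<in>J. centers k ((S - fst j) \<union> snd j) \<and> finite (fst j) \<and> finite (snd j) \<and>
          card (fst j) + card (snd j) \<le> 2 ^ (b * (q + 1))) \<and>
       (\<Sum>j\<in>J. clustering_cost p C ((S - fst j) \<union> snd j)) \<le> card J * clustering_cost p C S
         + clustering_cost p C T - clustering_cost p C S
         + (clustering_cost p C S + clustering_cost p C T) / 2 ^ (q + 5))"
proof -
  obtain \<kappa> :: nat where \<kappa>: "1 \<le> \<kappa>" and slack: "\<And>N s (L::'a set) G. finite L \<Longrightarrow> finite G \<Longrightarrow> card G + s = card L \<Longrightarrow>
     card L \<le> 24 * 2 ^ N * s \<or> card L \<le> 2 * 2 ^ N \<Longrightarrow>
     \<exists>J. swap_family L G (2 ^ (3 + 2 * \<kappa> * (N + 10 + \<kappa>))) J \<and> 16 * card J \<le> 16 + 2 * card L \<and>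
       (\<forall>j\<in>J. separates (snd j) (fst j) (G - snd j))"
    using slack_swap_family by blast
  \<comment> \<open>\<open>n1\<close> is the sum of the coefficients of \<open>N\<close>, defined
    below, as a linear function of \<open>q\<close>; therefore
    \<open>N \<le> n1 * (q + 1)\<close>.\<close>
  define n1 where "n1 = 18 + 14 * p + p * p"
  show ?thesis
  proof (rule exI[of _ "4 + 2 * \<kappa> * (n1 + 10 + \<kappa>)"], intro conjI allI impI)
    fix q k :: nat and C S T :: "'a set"
    assume C: "finite C" "C \<noteq> {}" and S: "centers k S" and T: "centers k T"
    \<comment> \<open>The parameters make the total error four times \<open>X / 2 ^ (q + 7)\<close>, with \<open>X\<close> the sum of both costs.\<close>
    define a where "a = q + 7 + p + (p + q + 8) * p"
    define N where "N = q + 9 + 4 * p + a"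
    define \<theta> \<tau> \<nu> where "\<theta> = 1 / (2::real) ^ (q + 7)" and "\<tau> = 1 / (2::real) ^ a" and "\<nu> = 1 / (2::real) ^ N"
    obtain L where L: "S \<subseteq> L" "finite L" "card L = k"
      using superset_of_card[OF infinite_UNIV_euclidean, of S k] S by (auto simp: centers_def)
    obtain G where G: "T \<subseteq> G" "finite G" "card G = k"
      using superset_of_card[OF infinite_UNIV_euclidean, of T k] T by (auto simp: centers_def)
    have "G \<noteq> {}" using G(1) T by (auto simp: centers_def)
    obtain l where l: "\<And>x. l x \<in> S" "clustering_cost p C S = (\<Sum>x\<in>C. dist x (l x) ^ p)"
      using clustering_cost_attained[of S p C] S by (auto simp: centers_def)
    obtain g where g: "\<And>x. g x \<in> G" "clustering_cost p C G = (\<Sum>x\<in>C. dist x (g x) ^ p)"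
      using clustering_cost_attained[OF G(2) \<open>G \<noteq> {}\<close>, of p C] by blast
    define X where "X = clustering_cost p C S + clustering_cost p C G"
    have cG: "clustering_cost p C G \<le> clustering_cost p C T"
      using G T by (intro clustering_cost_antimono) (auto simp: centers_def)
    have nn: "0 \<le> clustering_cost p C S" "0 \<le> clustering_cost p C G"
      unfolding l(2) g(2) by (auto intro: sum_nonneg)
    interpret two_clusterings C L G l g \<tau> p
      using C L G l g by unfold_locales (auto simp: \<tau>_def)
    have cX: "(\<Sum>x\<in>C. c x ^ p) \<le> 2 ^ p * X"
    proof -
      have "(\<Sum>x\<in>C. c x ^ p) \<le> (\<Sum>x\<in>C. 2 ^ p * (dist x (l x) ^ p + dist x (g x) ^ p))"
        unfolding c_def by (intro sum_mono power_add_le_double) auto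
      then show ?thesis by (simp add: X_def l(2) g(2) sum.distrib sum_distrib_left distrib_left)
    qed
    have "0 < \<nu>" "\<nu> \<le> 1" by (auto simp: \<nu>_def)
    from close_centers[OF this] obtain S0 I \<pi> h where
      S0: "S0 \<subseteq> G" "I \<subseteq> G - S0" "inj_on \<pi> I" "\<pi> ` I \<subseteq> l ` C" and h: "\<And>x. x \<in> C \<Longrightarrow> h x \<in> G - S0" and
      ch: "(\<Sum>x\<in>C. dist x (h x) ^ p) \<le> clustering_cost p C G + \<nu> * (3 * 8 ^ p / \<tau>) * (\<Sum>x\<in>C. c x ^ p)" and
      iso: "(\<Sum>f\<in>I. card {x\<in>C. (l x = \<pi> f) \<noteq> (h x = f)} * dist (\<pi> f) f ^ p) \<le> \<tau> * (\<Sum>x\<in>C. c x ^ p)" and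
      alt: "\<nu> * (real (card G) - real (card I)) \<le> 24 * card S0 \<or> \<nu> * (real (card G) - real (card I)) \<le> 2"
      unfolding g(2) by blast
    \<comment> \<open>Removing the pairs takes equally many centers from both sides, so
      \<open>Lb\<close> exceeds \<open>Gb\<close> by exactly \<open>card S0\<close>. This is the
      slack that pays for the separators.\<close>
    define Lb Gb where "Lb = L - \<pi> ` I" and "Gb = G - S0 - I"
    have finI: "finite I" using S0(2) G(2) by (meson finite_Diff finite_subset)
    have \<pi>S: "\<pi> ` I \<subseteq> S" by (rule subset_trans[OF S0(4) image_subsetI[OF l(1)]])
    have cLb: "card Lb + card I = k"
    proof -
      have "card Lb = card L - card (\<pi> ` I)"
        unfolding Lb_def using \<pi>S L(1) finI by (intro card_Diff_subset) auto
      moreover have "card (\<pi> ` I) \<le> card L" using \<pi>S L by (intro card_mono) auto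
      ultimately show ?thesis using card_image[OF S0(3)] L(3) by simp
    qed
    have cGb: "card Gb + card S0 = card Lb"
    proof -
      have "card (G - S0) = card G - card S0" using S0(1) G(2) by (intro card_Diff_subset) (auto intro: finite_subset)
      moreover have "card Gb = card (G - S0) - card I" unfolding Gb_def using S0(2) finI by (intro card_Diff_subset)
      moreover have "card S0 \<le> card G" "card I \<le> card (G - S0)" using S0(1,2) G(2) by (auto intro: card_mono)
      ultimately show ?thesis using cLb G(3) by linarith
    qed
    have "card Lb \<le> 24 * 2 ^ N * card S0 \<or> card Lb \<le> 2 * 2 ^ N"
    proof -
      have "real (card G) - real (card I) = card Lb" using cLb G(3) by linarith
      then have "real (card Lb) \<le> real (24 * 2 ^ N * card S0) \<or> real (card Lb) \<le> real (2 * 2 ^ N)"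
        using alt by (simp add: \<nu>_def field_simps)
      then show ?thesis by (simp only: of_nat_le_iff)
    qed
    then obtain J1 where J1: "swap_family Lb Gb (2 ^ (3 + 2 * \<kappa> * (N + 10 + \<kappa>))) J1" "16 * card J1 \<le> 16 + 2 * card Lb"
       "\<And>j. j \<in> J1 \<Longrightarrow> separates (snd j) (fst j) (Gb - snd j)"
      using slack[of Lb Gb "card S0" N] cGb L(2) G(2) by (auto simp: Lb_def Gb_def)
    obtain J2 where J2: "swap_family (\<pi> ` I) I 16 J2" "16 * card J2 \<le> 16 + card I" "\<And>j. j \<in> J2 \<Longrightarrow> snd j \<subseteq> I \<and> fst j = \<pi> ` snd j"
      using paired_swap_family[OF finI S0(3)] by blast
    define J where "J = J1 \<union> J2"
    have disj: "Lb \<inter> \<pi> ` I = {}" by (auto simp: Lb_def)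
    have finS: "finite S" using S by (simp add: centers_def)
    have \<theta>: "0 < \<theta>" "\<theta> \<le> 1" by (auto simp: \<theta>_def)
    have hGI: "h x \<in> Gb \<union> I" if "x \<in> C" for x using h[OF that] by (auto simp: Gb_def)
    have nonempty: "(S - fst j) \<union> snd j \<noteq> {}" if "j \<in> J" for j
      by (rule sum_swap_costs_paired_le(1)[OF C(1) finS finI _ _ J1(1) _ J2(1) _ disj \<pi>S \<theta> C(2) that[unfolded J_def]])
        (use l(1) hGI J1(3) J2(3) in blast)+
    have costs: "(\<Sum>j\<in>J. clustering_cost p C ((S - fst j) \<union> snd j)) \<le>
      card J * clustering_cost p C S + (\<Sum>x\<in>C. dist x (h x) ^ p) - clustering_cost p C S
      + (\<theta> * (clustering_cost p C S + (\<Sum>x\<in>C. dist x (h x) ^ p))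
      + (2 ^ (p + 1) / \<theta>) ^ p * (\<Sum>f\<in>I. card {x\<in>C. (l x = \<pi> f) \<noteq> (h x = f)} * dist (\<pi> f) f ^ p))"
      unfolding J_def l(2)
      by (rule sum_swap_costs_paired_le(2)[OF C(1) finS finI _ _ J1(1) _ J2(1) _ disj \<pi>S \<theta>])
        (use l(1) hGI J1(3) J2(3) in blast)+
    have U: "swap_family (Lb \<union> \<pi> ` I) (Gb \<union> I) (max (2 ^ (3 + 2 * \<kappa> * (N + 10 + \<kappa>))) 16) J"
      unfolding J_def by (rule swap_family_Un[OF J1(1) J2(1) disj])
    have LbL: "Lb \<union> \<pi> ` I = L" using \<pi>S L(1) by (auto simp: Lb_def)
    have size: "2 * max (2 ^ (3 + 2 * \<kappa> * (N + 10 + \<kappa>))) 16 \<le> (2::nat) ^ ((4 + 2 * \<kappa> * (n1 + 10 + \<kappa>)) * (q + 1))"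
    proof -
      have "(16::nat) = 2 ^ 4" by simp
      also have "\<dots> \<le> 2 ^ (3 + 2 * \<kappa> * (N + 10 + \<kappa>))" using \<kappa> by (intro power_increasing) auto
      finally have "2 * max (2 ^ (3 + 2 * \<kappa> * (N + 10 + \<kappa>))) 16 = (2::nat) ^ (4 + 2 * \<kappa> * (N + 10 + \<kappa>))"
        by (simp add: max_def power_add)
      also have "\<dots> \<le> 2 ^ ((4 + 2 * \<kappa> * (n1 + 10 + \<kappa>)) * (q + 1))"
      proof (intro power_increasing)
        have "N \<le> n1 * (q + 1)" by (simp add: N_def a_def n1_def algebra_simps)
        then have "N + 10 + \<kappa> \<le> (n1 + 10 + \<kappa>) * (q + 1)" by (simp add: algebra_simps)
        then have "2 * \<kappa> * (N + 10 + \<kappa>) \<le> 2 * \<kappa> * ((n1 + 10 + \<kappa>) * (q + 1))" by (rule mult_le_mono2)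
        moreover have "4 \<le> 4 * (q + 1)" by simp
        ultimately show "4 + 2 * \<kappa> * (N + 10 + \<kappa>) \<le> (4 + 2 * \<kappa> * (n1 + 10 + \<kappa>)) * (q + 1)"
          unfolding add_mult_distrib mult.assoc[of "2 * \<kappa>"] by linarith
      qed simp
      finally show ?thesis .
    qed
    show "\<exists>J. finite J \<and> 8 * card J \<le> 16 + k \<and>
       (\<forall>j\<in>J. centers k ((S - fst j) \<union> snd j) \<and> finite (fst j) \<and> finite (snd j) \<and>
          card (fst j) + card (snd j) \<le> 2 ^ ((4 + 2 * \<kappa> * (n1 + 10 + \<kappa>)) * (q + 1))) \<and>
       (\<Sum>j\<in>J. clustering_cost p C ((S - fst j) \<union> snd j)) \<le> card J * clustering_cost p C S
         + clustering_cost p C T - clustering_cost p C S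
         + (clustering_cost p C S + clustering_cost p C T) / 2 ^ (q + 5)"
    proof (intro exI[of _ J] conjI ballI)
      show "finite J" using U by (simp add: swap_family_def)
      have "card J \<le> card J1 + card J2" unfolding J_def by (rule card_Un_le)
      then show "8 * card J \<le> 16 + k" using J1(2) J2(2) cLb by linarith
    next
      fix j assume j: "j \<in> J"
      have fj: "fst j \<subseteq> L" "finite (snd j)" "card (snd j) \<le> card (fst j)" "card (fst j) \<le> max (2 ^ (3 + 2 * \<kappa> * (N + 10 + \<kappa>))) 16"
        using U j unfolding LbL swap_family_def by blast+
      show fin: "finite (fst j)" "finite (snd j)" using fj L(2) finite_subset by auto
      show "card (fst j) + card (snd j) \<le> 2 ^ ((4 + 2 * \<kappa> * (n1 + 10 + \<kappa>)) * (q + 1))"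
        using fj(3,4) size by linarith
      \<comment> \<open>Swaps are balanced with respect to the padded set \<open>L\<close>, so
        \<open>fst j\<close> may contain centers missing from \<open>S\<close>. Counting in
        \<open>L\<close> still bounds the result by \<open>k\<close>.\<close>
      have "card ((S - fst j) \<union> snd j) \<le> card (S - fst j) + card (snd j)" by (rule card_Un_le)
      also have "card (S - fst j) \<le> card (L - fst j)" using L by (intro card_mono) auto
      also have "card (L - fst j) = card L - card (fst j)" using fj(1) fin by (intro card_Diff_subset) auto
      finally have "card ((S - fst j) \<union> snd j) \<le> k"
        using fj(3) card_mono[OF L(2) fj(1)] L(3) by linarith
      then show "centers k ((S - fst j) \<union> snd j)"
        using nonempty[OF j] finS fin unfolding centers_def by auto
    next
      define E where "E = X / 2 ^ (q + 7)"
      have E0: "0 \<le> E" "E \<le> X" using nn by (auto simp: E_def X_def divide_le_eq mult_le_cancel_left1)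
      have "\<nu> * (3 * 8 ^ p / \<tau>) * (\<Sum>x\<in>C. c x ^ p) \<le> \<nu> * (3 * 8 ^ p / \<tau>) * (2 ^ p * X)"
        using cX by (intro mult_left_mono) (auto simp: \<nu>_def \<tau>_def)
      also have "\<dots> = (3 / 4) * E"
      proof -
        have "(8::real) ^ p * 2 ^ p = 2 ^ (4 * p)" by (simp add: power_mult flip: power_mult_distrib)
        then show ?thesis
          by (simp add: \<nu>_def \<tau>_def N_def E_def power_add field_simps)
      qed
      also have "\<dots> \<le> E" using E0 by simp
      finally have ch': "(\<Sum>x\<in>C. dist x (h x) ^ p) \<le> clustering_cost p C G + E" using ch by linarith
      have "2 ^ (p + 1) / \<theta> = 2 ^ (p + q + 8)" by (simp add: \<theta>_def power_add)
      then have "(2 ^ (p + 1) / \<theta>) ^ p = 2 ^ ((p + q + 8) * p)" by (simp only: power_mult)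
      moreover have "(\<Sum>f\<in>I. card {x\<in>C. (l x = \<pi> f) \<noteq> (h x = f)} * dist (\<pi> f) f ^ p) \<le> \<tau> * (2 ^ p * X)"
        using iso cX mult_left_mono[OF cX, of \<tau>] by (simp add: \<tau>_def)
      ultimately have "(2 ^ (p + 1) / \<theta>) ^ p * (\<Sum>f\<in>I. card {x\<in>C. (l x = \<pi> f) \<noteq> (h x = f)} * dist (\<pi> f) f ^ p)
          \<le> 2 ^ ((p + q + 8) * p) * (\<tau> * (2 ^ p * X))" by (simp add: mult_left_mono)
      also have "\<dots> = E" by (simp add: \<tau>_def a_def E_def power_add)
      finally have 1: "(2 ^ (p + 1) / \<theta>) ^ p * (\<Sum>f\<in>I. card {x\<in>C. (l x = \<pi> f) \<noteq> (h x = f)} * dist (\<pi> f) f ^ p) \<le> E" .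
      have "\<theta> * (clustering_cost p C S + (\<Sum>x\<in>C. dist x (h x) ^ p)) \<le> \<theta> * (2 * X)"
        using ch' E0 \<theta> nn by (intro mult_left_mono) (auto simp: X_def)
      also have "\<dots> = 2 * E" by (simp add: \<theta>_def E_def)
      finally have 2: "\<theta> * (clustering_cost p C S + (\<Sum>x\<in>C. dist x (h x) ^ p)) \<le> 2 * E" .
      have "(\<Sum>j\<in>J. clustering_cost p C ((S - fst j) \<union> snd j)) \<le> card J * clustering_cost p C S
         + clustering_cost p C G - clustering_cost p C S + 4 * E"
        using costs 1 2 ch' by linarith
      moreover have "4 * E \<le> (clustering_cost p C S + clustering_cost p C T) / 2 ^ (q + 5)"
      proof -
        have "4 * E = X / 2 ^ (q + 5)" by (simp add: E_def power_add)
        also have "\<dots> \<le> (clustering_cost p C S + clustering_cost p C T) / 2 ^ (q + 5)"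
          using cG by (intro divide_right_mono) (auto simp: X_def)
        finally show ?thesis .
      qed
      ultimately show "(\<Sum>j\<in>J. clustering_cost p C ((S - fst j) \<union> snd j)) \<le> card J * clustering_cost p C S
         + clustering_cost p C T - clustering_cost p C S
         + (clustering_cost p C S + clustering_cost p C T) / 2 ^ (q + 5)"
        using cG by linarith
    qed
  qed simp
qed

text \<open>With no more clients than centers, a positive cost could be improved: opening a center
  at the most expensive client \<open>x0\<close> saves at least the average
  \<open>cost / card C\<close>, more than the stopping rule tolerates.\<close>

lemma cost_zero_of_many_centers:
  fixes C S :: "'a::metric_space set"
  assumes p: "p > 0" and C: "finite C" "card C \<le> k" and S: "centers k S" and \<epsilon>: "\<epsilon> \<le> 1" and s: "2 \<le> s"
    and opt: "\<And>S'. \<not> local_search_step (clustering_cost p C) C \<epsilon> k s S S'"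
  shows "clustering_cost p C S = 0"
proof (rule ccontr)
  assume "clustering_cost p C S \<noteq> 0"
  have finS: "finite S" "S \<noteq> {}" "card S \<le> k" using S by (auto simp: centers_def)
  have pos: "0 < clustering_cost p C S"
    using clustering_cost_nonneg[OF finS(1,2), of p C] \<open>clustering_cost p C S \<noteq> 0\<close> by linarith
  obtain l where l: "\<And>x. l x \<in> S" "clustering_cost p C S = (\<Sum>x\<in>C. dist x (l x) ^ p)"
    using clustering_cost_attained[OF finS(1,2), of p C] by blast
  define a where "a x = dist x (l x) ^ p" for x
  have ne: "C \<noteq> {}" using pos by (auto simp: clustering_cost_def)
  have "Max (a ` C) \<in> a ` C" using C(1) ne by (intro Max_in) auto
  then obtain x0 where x0: "x0 \<in> C" "Max (a ` C) = a x0" by blast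
  have "sum a C \<le> card C * a x0"
    using sum_bounded_above[of C a "a x0"] x0(2) C(1) by (metis Max_ge finite_imageI imageI)
  then have big: "clustering_cost p C S / card C \<le> a x0"
    using ne C(1) by (simp add: l(2) a_def[symmetric] divide_le_eq mult.commute card_gt_0_iff)
  obtain D where D: "D \<subseteq> S" "card D \<le> 1" "card (S - D) + 1 \<le> k" "\<And>x. x \<in> C - {x0} \<Longrightarrow> l x \<notin> D"
  proof (cases "card S < k")
    case True
    then show thesis by (intro that[of "{}"]) auto
  next
    case False
    have "card (l ` (C - {x0})) \<le> card (C - {x0})" using C(1) by (intro card_image_le) auto
    also have "\<dots> < card S" using False C x0(1) card_gt_0_iff[of C] by (auto simp: card_Diff_singleton)
    finally obtain u where u: "u \<in> S" "u \<notin> l ` (C - {x0})"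
      by (metis C(1) card_mono finite_Diff finite_imageI linorder_not_less subsetI)
    have "card (S - {u}) = card S - 1" using u(1) by simp
    moreover have "0 < card S" using finS(1,2) by (simp add: card_gt_0_iff)
    ultimately show thesis using u finS(3) by (intro that[of "{u}"]) auto
  qed
  define S' where "S' = insert x0 (S - D)"
  have "clustering_cost p C S' \<le> (\<Sum>x\<in>C. if x = x0 then 0 else a x)"
  proof (rule clustering_cost_le)
    show "finite S'" using finS(1) by (simp add: S'_def)
    fix x assume x: "x \<in> C"
    show "\<exists>u\<in>S'. dist x u ^ p \<le> (if x = x0 then 0 else a x)"
    proof (cases "x = x0")
      case True
      then show ?thesis using p by (intro bexI[of _ x0]) (auto simp: S'_def zero_power)
    next
      case False
      then show ?thesis using x D(4)[of x] l(1)[of x] by (intro bexI[of _ "l x"]) (auto simp: S'_def a_def)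
    qed
  qed
  also have "\<dots> = sum a C - a x0"
    using C(1) x0(1) by (simp add: sum.remove[of C x0] sum.delta_remove cong: sum.cong)
  also have "\<dots> \<le> (1 - \<epsilon> / card C) * clustering_cost p C S"
  proof -
    have "\<epsilon> / card C * clustering_cost p C S \<le> 1 / card C * clustering_cost p C S"
      using \<epsilon> pos by (intro mult_right_mono divide_right_mono) auto
    then show ?thesis using big by (simp add: l(2) a_def[symmetric] algebra_simps)
  qed
  finally have "clustering_cost p C S' \<le> (1 - \<epsilon> / card C) * clustering_cost p C S" .
  moreover have "centers k S'"
    using finS(1) D(3) by (auto simp: centers_def S'_def card_insert_if)
  moreover have "card (S - S') + card (S' - S) \<le> s"
  proof -
    have "card (S - S') \<le> card D"
      using D(1) finS(1) by (intro card_mono) (auto simp: S'_def intro: finite_subset)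
    moreover have "card (S' - S) \<le> card {x0}" by (intro card_mono) (auto simp: S'_def)
    ultimately show ?thesis using D(2) s by simp
  qed
  ultimately show False using opt[of S'] by (simp add: local_search_step_def)
qed

lemma local_search_output_centers:
  assumes "local_search_output cost C \<epsilon> k s S" "0 < k"
  shows "centers k S"
proof -
  obtain S0 where S0: "finite S0" "card S0 = k" "(local_search_step cost C \<epsilon> k s)\<^sup>*\<^sup>* S0 S"
    using assms by (auto simp: local_search_output_def)
  from S0(3) show ?thesis
    by (cases rule: rtranclp.cases) (use S0(1,2) assms(2) in \<open>auto simp: local_search_step_def centers_def\<close>)
qed

section \<open>From test swaps to the approximation ratio\<close>

lemma approx_ratio:
  fixes \<epsilon> A B :: real
  assumes "0 < \<epsilon>" "\<epsilon> < 1 / 2" "0 \<le> A" "0 \<le> B" and le: "A * (1 - \<epsilon> / 2) \<le> B + (A + B) * (\<epsilon> / 32)"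
  shows "A \<le> (1 + \<epsilon>) * B"
proof -
  \<comment> \<open>\<open>17 / 32\<close> collects \<open>1 / 2\<close> from the stopping rule and
    \<open>1 / 32\<close> from the error proportional to \<open>A\<close>.\<close>
  have "A * (1 - 17 / 32 * \<epsilon>) \<le> B * (1 + \<epsilon> / 32)"
  proof -
    have "A * (1 - 17 / 32 * \<epsilon>) = A * (1 - \<epsilon> / 2) - A * (\<epsilon> / 32)" by (simp add: field_simps)
    also have "\<dots> \<le> (B + (A + B) * (\<epsilon> / 32)) - A * (\<epsilon> / 32)" using le by (rule diff_right_mono)
    also have "\<dots> = B * (1 + \<epsilon> / 32)" by (simp add: field_simps)
    finally show ?thesis .
  qed
  also have "\<dots> \<le> B * ((1 + \<epsilon>) * (1 - 17 / 32 * \<epsilon>))"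
  proof (intro mult_left_mono)
    have "\<epsilon> * \<epsilon> \<le> \<epsilon> * (1 / 2)" using assms by (intro mult_left_mono) auto
    moreover have "(1 + \<epsilon>) * (1 - 17 / 32 * \<epsilon>) = 1 + 15 / 32 * \<epsilon> - 17 / 32 * (\<epsilon> * \<epsilon>)"
      by (simp add: field_simps)
    ultimately show "1 + \<epsilon> / 32 \<le> (1 + \<epsilon>) * (1 - 17 / 32 * \<epsilon>)" using assms(1) by linarith
  qed fact
  finally have "A * (1 - 17 / 32 * \<epsilon>) \<le> ((1 + \<epsilon>) * B) * (1 - 17 / 32 * \<epsilon>)" by (simp add: mult_ac)
  then show ?thesis by (rule mult_right_le_imp_le) (use assms in simp)
qed

text \<open>Local optimality bounds each swap cost below by \<open>1 - \<epsilon> / card C\<close>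
  times the present cost. Summing over at most \<open>card C / 2\<close> swaps loses only
  \<open>\<epsilon> / 2\<close> times that cost.\<close>

lemma local_optimum_ratio:
  fixes C S T :: "'a::metric_space set" and s q :: nat
  assumes \<epsilon>: "0 < \<epsilon>" "\<epsilon> < 1 / 2" "1 \<le> \<epsilon> * 2 ^ q" and C: "finite C" "C \<noteq> {}"
    and S: "centers k S" and T: "centers k T"
    and opt: "\<And>S'. \<not> local_search_step (clustering_cost p C) C \<epsilon> k s S S'"
    and J: "finite J" "2 * card J \<le> card C"
      "\<And>j. j \<in> J \<Longrightarrow> centers k ((S - fst j) \<union> snd j) \<and> finite (fst j) \<and> finite (snd j) \<and> card (fst j) + card (snd j) \<le> s"
    and cost: "(\<Sum>j\<in>J. clustering_cost p C ((S - fst j) \<union> snd j)) \<le> card J * clustering_cost p C S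
         + clustering_cost p C T - clustering_cost p C S
         + (clustering_cost p C S + clustering_cost p C T) / 2 ^ (q + 5)"
  shows "clustering_cost p C S \<le> (1 + \<epsilon>) * clustering_cost p C T"
proof -
  let ?A = "clustering_cost p C S" and ?B = "clustering_cost p C T"
  have nn: "0 \<le> ?A" "0 \<le> ?B" using S T by (auto simp: centers_def intro: clustering_cost_nonneg)
  have "(1 - \<epsilon> / card C) * ?A \<le> clustering_cost p C ((S - fst j) \<union> snd j)" if j: "j \<in> J" for j
  proof -
    let ?S' = "(S - fst j) \<union> snd j"
    have "card (S - ?S') \<le> card (fst j)" "card (?S' - S) \<le> card (snd j)"
      using J(3)[OF j] by (auto intro: card_mono)
    then have "card (S - ?S') + card (?S' - S) \<le> s" using J(3)[OF j] by linarith
    then show ?thesis using opt[of ?S'] J(3)[OF j] by (auto simp: local_search_step_def)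
  qed
  then have "(\<Sum>j\<in>J. (1 - \<epsilon> / card C) * ?A) \<le> (\<Sum>j\<in>J. clustering_cost p C ((S - fst j) \<union> snd j))"
    by (rule sum_mono)
  then have "card J * ((1 - \<epsilon> / card C) * ?A) \<le> card J * ?A + ?B - ?A + (?A + ?B) / 2 ^ (q + 5)"
    using cost by simp
  then have 1: "?A - (card J * \<epsilon> / card C) * ?A \<le> ?B + (?A + ?B) / 2 ^ (q + 5)"
    by (simp add: algebra_simps)
  have "card J * \<epsilon> / card C \<le> \<epsilon> / 2"
  proof -
    have "real (2 * card J) \<le> real (card C)" using J(2) by (simp only: of_nat_le_iff)
    then have "\<epsilon> * (2 * card J) \<le> \<epsilon> * card C" using \<epsilon> by (intro mult_left_mono) auto
    then show ?thesis using C by (simp add: divide_le_eq card_gt_0_iff algebra_simps)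
  qed
  then have "(card J * \<epsilon> / card C) * ?A \<le> \<epsilon> / 2 * ?A" using nn by (intro mult_right_mono)
  moreover have "(?A + ?B) / 2 ^ (q + 5) \<le> (?A + ?B) * (\<epsilon> / 32)"
  proof -
    have "1 / 2 ^ (q + 5) \<le> \<epsilon> / 32" using \<epsilon>(3) by (simp add: power_add divide_le_eq)
    then show ?thesis using mult_left_mono[of "1 / 2 ^ (q + 5)" "\<epsilon> / 32" "?A + ?B"] nn by simp
  qed
  ultimately have "?A * (1 - \<epsilon> / 2) \<le> ?B + (?A + ?B) * (\<epsilon> / 32)"
    using 1 right_diff_distrib[of ?A 1 "\<epsilon> / 2"] mult.commute[of ?A "\<epsilon> / 2"] by linarith
  then show ?thesis by (rule approx_ratio[OF \<epsilon>(1,2) nn])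
qed

text \<open>For the first power \<open>2 ^ q\<close> above \<open>1 / \<epsilon>\<close>,
  \<open>2 * 2 ^ q\<close> is at most \<open>4 / \<epsilon>\<close>. As
  \<open>1 / \<epsilon> > 2\<close>, this is below the cube of \<open>1 / \<epsilon>\<close>, whence
  the exponent \<open>3 * b\<close>.\<close>

lemma power_two_scale:
  fixes \<epsilon> :: real and b :: nat
  assumes "0 < \<epsilon>" "\<epsilon> < 1 / 2"
  shows "\<exists>q. 1 \<le> \<epsilon> * 2 ^ q \<and> 2 ^ (b * (q + 1)) \<le> nat \<lfloor>1 / \<epsilon> powr real (3 * b)\<rfloor>"
proof -
  define y where "y = 1 / \<epsilon>"
  have y: "2 < y" using assms by (simp add: y_def field_simps)
  define q where "q = (LEAST q. y < 2 ^ q)"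
  have "\<exists>q. y < 2 ^ q" using real_arch_pow[of 2 y] by auto
  then have q: "y < 2 ^ q" unfolding q_def by (rule LeastI_ex)
  then have "0 < q" using y by (cases q) auto
  then have "\<not> y < 2 ^ (q - 1)" unfolding q_def by (intro not_less_Least) simp
  moreover have "(2::real) ^ q = 2 * 2 ^ (q - 1)" using \<open>0 < q\<close> by (cases q) auto
  ultimately have q2: "2 ^ q \<le> 2 * y" by simp
  have "(2::real) ^ (b * (q + 1)) = (2 * 2 ^ q) ^ b"
    by (metis mult.commute power_Suc Suc_eq_plus1 power_mult)
  also have "\<dots> \<le> (y ^ 3) ^ b"
  proof (intro power_mono)
    have "2 * 2 \<le> y * y" using y by (intro mult_mono) auto
    then have "4 * y \<le> y * y * y" using y by (intro mult_right_mono) auto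
    then show "2 * 2 ^ q \<le> y ^ 3" using q2 by (simp add: power3_eq_cube)
  qed simp
  also have "\<dots> = y powr real (3 * b)" using powr_realpow[of y "3 * b"] y by (simp add: power_mult)
  also have "\<dots> = 1 / \<epsilon> powr real (3 * b)" using assms by (simp add: y_def powr_divide)
  finally have "real (2 ^ (b * (q + 1))) \<le> 1 / \<epsilon> powr real (3 * b)" by simp
  then have "2 ^ (b * (q + 1)) \<le> nat \<lfloor>1 / \<epsilon> powr real (3 * b)\<rfloor>" by (simp only: le_nat_floor)
  moreover have "1 \<le> \<epsilon> * 2 ^ q" using q assms by (simp add: y_def field_simps)
  ultimately show ?thesis by blast
qed

theorem theorem1:
  fixes p :: nat
  assumes "p > 0"
  shows "\<exists>c::real. c > 0 \<and>
    (\<forall>(\<epsilon>::real) (C :: (real ^ 'd::finite) set) (k::nat) S.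
       0 < \<epsilon> \<longrightarrow> \<epsilon> < 1 / 2 \<longrightarrow> finite C \<longrightarrow> k > 0 \<longrightarrow>
       local_search_output (clustering_cost p C) C \<epsilon> k (nat \<lfloor>1 / \<epsilon> powr c\<rfloor>) S \<longrightarrow>
       clustering_cost p C S \<le> (1 + \<epsilon>) * (INF T\<in>{T. centers k T}. clustering_cost p C T))"
proof -
  obtain b :: nat where b: "4 \<le> b" and swaps: "\<And>q k (C::(real ^ 'd) set) S T. finite C \<Longrightarrow> C \<noteq> {} \<Longrightarrow>
     centers k S \<Longrightarrow> centers k T \<Longrightarrow>
     \<exists>J. finite J \<and> 8 * card J \<le> 16 + k \<and>
       (\<forall>j\<in>J. centers k ((S - fst j) \<union> snd j) \<and> finite (fst j) \<and> finite (snd j) \<and>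
          card (fst j) + card (snd j) \<le> 2 ^ (b * (q + 1))) \<and>
       (\<Sum>j\<in>J. clustering_cost p C ((S - fst j) \<union> snd j)) \<le> card J * clustering_cost p C S
         + clustering_cost p C T - clustering_cost p C S
         + (clustering_cost p C S + clustering_cost p C T) / 2 ^ (q + 5)"
    using test_swaps[where p = p and 'a = "real ^ 'd"] by blast
  show ?thesis
  proof (rule exI[of _ "real (3 * b)"], intro conjI allI impI)
    show "0 < real (3 * b)" using b by simp
    fix \<epsilon> :: real and C :: "(real ^ 'd) set" and k :: nat and S
    assume \<epsilon>: "0 < \<epsilon>" "\<epsilon> < 1 / 2" and C: "finite C" and k: "0 < k"
      and out: "local_search_output (clustering_cost p C) C \<epsilon> k (nat \<lfloor>1 / \<epsilon> powr real (3 * b)\<rfloor>) S"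
    define s where "s = nat \<lfloor>1 / \<epsilon> powr real (3 * b)\<rfloor>"
    obtain q where q: "1 \<le> \<epsilon> * 2 ^ q" "2 ^ (b * (q + 1)) \<le> s"
      using power_two_scale[OF \<epsilon>, of b] unfolding s_def by blast
    have "(16::nat) = 2 ^ 4" by simp
    also have "\<dots> \<le> 2 ^ (b * (q + 1))" using b by (intro power_increasing) auto
    finally have s16: "16 \<le> s" using q(2) by linarith
    have opt: "\<not> local_search_step (clustering_cost p C) C \<epsilon> k s S S'" for S'
      using out unfolding local_search_output_def s_def by blast
    have S: "centers k S" using local_search_output_centers[OF out k] .
    have "clustering_cost p C S \<le> (1 + \<epsilon>) * clustering_cost p C T" if T: "centers k T" for T
    proof -
      have Tnn: "0 \<le> clustering_cost p C T" using T by (auto simp: centers_def intro: clustering_cost_nonneg)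
      \<comment> \<open>\<open>test_swaps\<close> gives up to \<open>2 + k / 8\<close> swaps, which
        is too many when clients or centers are few. For \<open>k \<le> 3\<close> a single exchange
        of \<open>S\<close> for \<open>T\<close> is within the neighborhood.\<close>
      consider "card C \<le> k" | "k < card C" "k \<le> 3" | "k < card C" "4 \<le> k" by linarith
      then show ?thesis
      proof cases
        case 1
        then have "clustering_cost p C S = 0"
          using cost_zero_of_many_centers[OF assms C 1 S _ _ opt] \<epsilon> s16 by simp
        then show ?thesis using Tnn \<epsilon> by simp
      next
        case 2
        then have "C \<noteq> {}" by auto
        have "finite S" "finite T" "card S \<le> 3" "card T \<le> 3" using S T 2 by (auto simp: centers_def)
        then show ?thesis
          using 2 k T s16 Tnn clustering_cost_nonneg[of S p C] S
          by (intro local_optimum_ratio[OF \<epsilon> q(1) C \<open>C \<noteq> {}\<close> S T opt, of "{(S, T)}"]) (auto simp: centers_def)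
      next
        case 3
        then have "C \<noteq> {}" by auto
        obtain J where J: "finite J" "8 * card J \<le> 16 + k"
          "\<And>j. j \<in> J \<Longrightarrow> centers k ((S - fst j) \<union> snd j) \<and> finite (fst j) \<and> finite (snd j) \<and>
            card (fst j) + card (snd j) \<le> 2 ^ (b * (q + 1))"
          "(\<Sum>j\<in>J. clustering_cost p C ((S - fst j) \<union> snd j)) \<le> card J * clustering_cost p C S
           + clustering_cost p C T - clustering_cost p C S
           + (clustering_cost p C S + clustering_cost p C T) / 2 ^ (q + 5)"
          using swaps[OF C \<open>C \<noteq> {}\<close> S T, of q] by blast
        \<comment> \<open>\<open>2 * card J \<le> 4 + k / 4\<close>, and this is at most
          \<open>k + 1\<close> precisely when \<open>k \<ge> 4\<close>.\<close>
        have "2 * card J \<le> card C" using J(2) 3 by linarith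
        then show ?thesis
          using J q(2) by (intro local_optimum_ratio[OF \<epsilon> q(1) C \<open>C \<noteq> {}\<close> S T opt J(1)]) (auto intro: order_trans)
      qed
    qed
    then have "clustering_cost p C S / (1 + \<epsilon>) \<le> (INF T\<in>{T. centers k T}. clustering_cost p C T)"
      using S \<epsilon> by (intro cINF_greatest) (auto simp: divide_le_eq mult.commute)
    then show "clustering_cost p C S \<le> (1 + \<epsilon>) * (INF T\<in>{T. centers k T}. clustering_cost p C T)"
      using \<epsilon> by (simp add: divide_le_eq mult.commute)
  qed
qed

end
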